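(* Let $n\ge 1$, $d\ge 2$, $p\ge 1$ (with $d\le p$) be integers for which conditions $\mathbf H_1$ and $\mathbf H_2$ (stated in the context) hold. Let $L\ge 0$. Then $$\Delta^*=\sup_{Q\in\mathcal Q_n}\ \sup_{\|S\|\le r}\Delta_{Q,S}\ \le\ -c_n^2+\frac{2\sqrt d\,\phi_*L}{p}\,c_n ,$$ where the inner supremum is over Lipschitz $1$-periodic functions $S$ with $\|S\|\le r$ and $\sup_{0\le s,t\le1,\ s\neq t}|S(t)-S(s)|/|t-s|\le L$, and $$\Delta_{Q,S}=E_{Q,S}|\theta^*-\theta|_d^2-E_{Q,S}|\hat\theta-\theta|_d^2 .$$
   Context: Model. $n,p\ge1$ are integers and $t_j=j/p$. The process $(y_t)_{0\le t\le n}$ obeys $dy_t=S(t)\,dt+d\xi_t$, where $S:\mathbb R\to\mathbb R$ is an unknown $1$-periodic function in $L_2[0,1]$ and $(\xi_t)$ is a square integrable semimartingale with paths in the Skorokhod space $D[0,n]$ whose unknown distribution $Q$ belongs to a family $\mathcal Q_n$; only $(y_{t_j})_{0\le j\le np}$ is observed. For each $Q$ there is a constant $\varkappa_Q>0$ such that, for every $f\in L_2[0,n]$, $I_n(f)=\int_0^nf(s)\,d\xi_s$ satisfies $E_QI_n(f)=0$ and $E_QI_n^2(f)\le\varkappa_Q\int_0^nf^2(s)\,ds$. $E_{Q,S}$ is expectation under the law of $y$. $\|f\|^2=\int_0^1f^2(t)\,dt$, $(f,g)$ is the inner product of $L_2[0,1]$, and $|x|_d^2=\sum_{j=1}^dx_j^2$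 for $x\in\mathbb R^p$, $p\ge d$. Basis and coefficients. $(\phi_j)_{1\le j\le p}$ are $1$-periodic functions in $L_2[0,1]$ with $\frac1p\sum_{l=1}^p\phi_i(t_l)\phi_j(t_l)=\mathbf 1_{\{i=j\}}$ and $\sup_{1\le j\le p}\sup_{0\le t\le1}|\phi_j(t)|\le\phi_*$ for a constant $\phi_*\ge1$ (possibly depending on $n$). Put $\psi_j(t)=\sum_{k=1}^{np}\phi_j(t_k)\mathbf 1_{(t_{k-1},t_k]}(t)$, $\theta_j=\frac1p\sum_{l=1}^pS(t_l)\phi_j(t_l)$, $\bar\theta_j=(S,\psi_j)$, $\hat\theta_j=\frac1n\sum_{l=1}^{np}\phi_j(t_l)(y_{t_l}-y_{t_{l-1}})$, $\xi_j=n^{-1/2}I_n(\psi_j)$, so $\hat\theta_j=\bar\theta_j+n^{-1/2}\xi_j$. Write $\theta=(\theta_j)_{1\le j\le p}$, etc. Condition $\mathbf H_1$: $\varkappa^*=\sup_{Q\in\mathcal Q_n}\varkappa_Q<\infty$, and $n^{-\epsilon}\varkappa^*\to0$ as $n\to\infty$ for every $\epsilon>0$. Condition $\mathbf H_2$ (at $(n,p,d)$, with $d\le p$): there is a $\sigma$-field $\mathcal G$ such that for every $Q\in\mathcal Q_n$ the vector $(\xi_j)_{1\le j\le d}$ is $\mathcal G$-conditionally (centered) Gaussian with covariance matrix $G=G_Q=(E_Q(\xi_i\xi_j|\mathcal G))_{1\le i,j\le d}$, and for some nonrandom constant $l_*=l_*(p,d)>0$, $\inf_{Q\in\mathcal Q_n}(\mathrm{tr}\,G-\lambda_{\max}(G))\ge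 l_*$ a.s., where $\lambda_{\max}$ is the maximal eigenvalue. (In general $\mathbf H_2$ asks for this for all $p\ge p_0$ and all $d\ge d_0$, for some $p_0,d_0\ge1$.) Shrinkage estimator. $\theta_j^*=(1-g(j))\hat\theta_j$ with $g(j)=\frac{c_n}{|\hat\theta|_d}\mathbf 1_{\{1\le j\le d\}}$, $c_n=\dfrac{l_*}{n\,(r+\sqrt{\bar d\,\varkappa^*})}$, $\bar d=d/n$. Here $r=r_n>0$ is a parameter (possibly depending on $n$) with $n^{-\epsilon}r_n\to0$ for every $\epsilon>0$. *)

theory Defs
  imports "HOL-Probability.Probability" "Jordan_Normal_Form.Char_Poly"
begin

definition one_periodic :: "(real \<Rightarrow> real) \<Rightarrow> bool" where
  "one_periodic f \<longleftrightarrow> (\<forall>t. f (t + 1) = f t)"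

definition L2_on :: "real \<Rightarrow> real \<Rightarrow> (real \<Rightarrow> real) \<Rightarrow> bool" where
  "L2_on a b f \<longleftrightarrow> f \<in> borel_measurable borel \<and> set_integrable lborel {a..b} (\<lambda>x. (f x)\<^sup>2)"

definition L2_norm01 :: "(real \<Rightarrow> real) \<Rightarrow> real" where
  "L2_norm01 f = sqrt (LINT x:{0..1}|lborel. (f x)\<^sup>2)"

definition dnorm :: "nat \<Rightarrow> (nat \<Rightarrow> real) \<Rightarrow> real" where
  "dnorm d x = sqrt (\<Sum>j = 1..d. (x j)\<^sup>2)"

definition cadlag_on :: "real \<Rightarrow> (real \<Rightarrow> real) \<Rightarrow> bool" where
  "cadlag_on T x \<longleftrightarrow>
     (\<forall>t\<in>{0..<T}. (x \<longlongrightarrow> x t) (at_right t)) \<and>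
     (\<forall>t\<in>{0<..T}. \<exists>l. (x \<longlongrightarrow> l) (at_left t))"

definition finite_variation_on :: "real \<Rightarrow> (real \<Rightarrow> real) \<Rightarrow> bool" where
  "finite_variation_on T x \<longleftrightarrow>
     (\<exists>B. \<forall>N (u :: nat \<Rightarrow> real). mono u \<and> range u \<subseteq> {0..T} \<longrightarrow>
        (\<Sum>i<N. \<bar>x (u (Suc i)) - x (u i)\<bar>) \<le> B)"


section \<open>Semimartingales on a bounded time interval\<close>

definition adapted_on :: "(real \<Rightarrow> 'a measure) \<Rightarrow> real \<Rightarrow> (real \<Rightarrow> 'a \<Rightarrow> real) \<Rightarrow> bool" where
  "adapted_on F T X \<longleftrightarrow> (\<forall>t\<in>{0..T}. X t \<in> borel_measurable (F t))"

definition martingale_on ::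
  "'a measure \<Rightarrow> (real \<Rightarrow> 'a measure) \<Rightarrow> real \<Rightarrow> (real \<Rightarrow> 'a \<Rightarrow> real) \<Rightarrow> bool" where
  "martingale_on M F T X \<longleftrightarrow>
     adapted_on F T X \<and> (\<forall>t\<in>{0..T}. integrable M (X t)) \<and>
     (\<forall>s t. 0 \<le> s \<and> s \<le> t \<and> t \<le> T \<longrightarrow>
        (AE \<omega> in M. real_cond_exp M (F s) (X t) \<omega> = X s \<omega>))"

text \<open>On \<open>[0,T]\<close> a localizing sequence takes values in \<open>[0,T]\<close> and almost surely is eventually
  equal to \<open>T\<close>.\<close>

definition local_martingale_on ::
  "'a measure \<Rightarrow> (real \<Rightarrow> 'a measure) \<Rightarrow> real \<Rightarrow> (real \<Rightarrow> 'a \<Rightarrow> real) \<Rightarrow> bool" where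
  "local_martingale_on M F T X \<longleftrightarrow>
     adapted_on F T X \<and> (\<forall>\<omega>\<in>space M. cadlag_on T (\<lambda>t. X t \<omega>)) \<and>
     (\<exists>\<tau> :: nat \<Rightarrow> 'a \<Rightarrow> real.
        (\<forall>k. stopping_time F (\<tau> k)) \<and>
        (\<forall>k. \<forall>\<omega>\<in>space M. 0 \<le> \<tau> k \<omega> \<and> \<tau> k \<omega> \<le> \<tau> (Suc k) \<omega> \<and> \<tau> k \<omega> \<le> T) \<and>
        (AE \<omega> in M. \<forall>\<^sub>F k in sequentially. \<tau> k \<omega> = T) \<and>
        (\<forall>k. martingale_on M F T (\<lambda>t \<omega>. X (min t (\<tau> k \<omega>)) \<omega> - X 0 \<omega>)))"

definition semimartingale_on ::
  "'a measure \<Rightarrow> (real \<Rightarrow> 'a measure) \<Rightarrow> real \<Rightarrow> (real \<Rightarrow> 'a \<Rightarrow> real) \<Rightarrow> bool" where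
  "semimartingale_on M F T X \<longleftrightarrow>
     filtration (space M) F \<and> (\<forall>t. subalgebra M (F t)) \<and> adapted_on F T X \<and>
     (\<exists>Y A. local_martingale_on M F T Y \<and> adapted_on F T A \<and>
        (\<forall>\<omega>\<in>space M. cadlag_on T (\<lambda>t. A t \<omega>) \<and> finite_variation_on T (\<lambda>t. A t \<omega>)) \<and>
        (AE \<omega> in M. \<forall>t\<in>{0..T}. X t \<omega> = Y t \<omega> + A t \<omega>))"

text \<open>The filtration lives on the completion of \<open>Q\<close>, so that it is allowed (but not required) to
  contain the \<open>Q\<close>-null sets.\<close>

definition square_integrable_semimartingale ::
  "'a measure \<Rightarrow> real \<Rightarrow> (real \<Rightarrow> 'a \<Rightarrow> real) \<Rightarrow> bool" where
  "square_integrable_semimartingale Q T X \<longleftrightarrow>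
     (\<forall>t\<in>{0..T}. X t \<in> borel_measurable Q \<and> integrable Q (\<lambda>\<omega>. (X t \<omega>)\<^sup>2)) \<and>
     (\<exists>F. semimartingale_on (completion Q) F T X)"


section \<open>Stochastic integrals of deterministic integrands\<close>

definition tendsto_in_prob ::
  "'a measure \<Rightarrow> (nat \<Rightarrow> 'a \<Rightarrow> real) \<Rightarrow> ('a \<Rightarrow> real) \<Rightarrow> bool" where
  "tendsto_in_prob M X Y \<longleftrightarrow>
     (\<forall>\<epsilon>>0. (\<lambda>k. measure M {\<omega>\<in>space M. \<epsilon> < \<bar>X k \<omega> - Y \<omega>\<bar>}) \<longlonglongrightarrow> 0)"

definition bounded_borel_on :: "real \<Rightarrow> (real \<Rightarrow> real) set" where
  "bounded_borel_on T = {f \<in> borel_measurable borel. \<exists>C. \<forall>x\<in>{0<..T}. \<bar>f x\<bar> \<le> C}"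

text \<open>The stochastic integral \<open>f \<mapsto> \<integral>\<^sub>0\<^sup>T f dX\<close> of bounded deterministic integrands with respect to a
  semimartingale is the (almost surely) unique linear map that takes the increment \<open>X\<^sub>t - X\<^sub>s\<close> on
  the indicator of \<open>(s,t]\<close> and satisfies the dominated convergence theorem in probability.
  An unbounded \<open>f\<close> is integrated as the limit in probability of the integrals of its truncations
  \<open>f 1\<^bsub>{|f| \<le> k}\<^esub>\<close>.\<close>

definition bounded_stoch_integral ::
  "'a measure \<Rightarrow> real \<Rightarrow> (real \<Rightarrow> 'a \<Rightarrow> real) \<Rightarrow> ((real \<Rightarrow> real) \<Rightarrow> 'a \<Rightarrow> real) \<Rightarrow> bool" where
  "bounded_stoch_integral M T X J \<longleftrightarrow>
     (\<forall>f\<in>bounded_borel_on T. J f \<in> borel_measurable M) \<and>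
     (\<forall>s t. 0 \<le> s \<and> s \<le> t \<and> t \<le> T \<longrightarrow>
        (AE \<omega> in M. J (indicator {s<..t}) \<omega> = X t \<omega> - X s \<omega>)) \<and>
     (\<forall>f\<in>bounded_borel_on T. \<forall>g\<in>bounded_borel_on T. \<forall>a b.
        (AE \<omega> in M. J (\<lambda>x. a * f x + b * g x) \<omega> = a * J f \<omega> + b * J g \<omega>)) \<and>
     (\<forall>h f. (\<forall>k. h k \<in> bounded_borel_on T) \<and> f \<in> bounded_borel_on T \<and>
        (\<exists>C. \<forall>k. \<forall>x\<in>{0<..T}. \<bar>h k x\<bar> \<le> C) \<and> (\<forall>x\<in>{0<..T}. (\<lambda>k. h k x) \<longlonglongrightarrow> f x) \<longrightarrow>
        tendsto_in_prob M (\<lambda>k. J (h k)) (J f))"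

definition has_stoch_integral ::
  "'a measure \<Rightarrow> real \<Rightarrow> (real \<Rightarrow> 'a \<Rightarrow> real) \<Rightarrow> (real \<Rightarrow> real) \<Rightarrow> ('a \<Rightarrow> real) \<Rightarrow> bool" where
  "has_stoch_integral M T X f Y \<longleftrightarrow>
     f \<in> borel_measurable borel \<and> Y \<in> borel_measurable M \<and>
     (\<exists>J. bounded_stoch_integral M T X J \<and>
        tendsto_in_prob M (\<lambda>k. J (\<lambda>x. if \<bar>f x\<bar> \<le> real k then f x else 0)) Y)"

definition stoch_integral ::
  "'a measure \<Rightarrow> real \<Rightarrow> (real \<Rightarrow> 'a \<Rightarrow> real) \<Rightarrow> (real \<Rightarrow> real) \<Rightarrow> 'a \<Rightarrow> real" where
  "stoch_integral M T X f = (SOME Y. has_stoch_integral M T X f Y)"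


section \<open>The noise model\<close>

text \<open>The noise \<open>\<xi>\<close> is a process on a measurable space \<open>\<Omega>\<close> and \<open>\<Q>\<close> a family of probability
  measures on \<open>\<Omega>\<close>. With \<open>\<Omega> = D[0,T]\<close> and \<open>\<xi>\<close> the coordinate process, \<open>\<Q>\<close> is a family of
  distributions of \<open>\<xi>\<close>; a larger \<open>\<Omega>\<close> lets the \<open>\<sigma>\<close>-field of condition \<open>H2\<close> carry
  information that is not contained in the path of \<open>\<xi>\<close>.\<close>

definition noise_model ::
  "real \<Rightarrow> 'a measure \<Rightarrow> (real \<Rightarrow> 'a \<Rightarrow> real) \<Rightarrow> 'a measure set \<Rightarrow> ('a measure \<Rightarrow> real) \<Rightarrow> bool" where
  "noise_model T \<Omega> \<xi> \<Q> \<kappa> \<longleftrightarrow>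
     (\<forall>\<omega>\<in>space \<Omega>. cadlag_on T (\<lambda>t. \<xi> t \<omega>)) \<and> \<Q> \<noteq> {} \<and>
     (\<forall>Q\<in>\<Q>. prob_space Q \<and> sets Q = sets \<Omega> \<and> square_integrable_semimartingale Q T \<xi> \<and>
        \<kappa> Q > 0 \<and>
        (\<forall>f. L2_on 0 T f \<longrightarrow>
           (\<exists>Y. has_stoch_integral Q T \<xi> f Y) \<and>
           integrable Q (stoch_integral Q T \<xi> f) \<and>
           integrable Q (\<lambda>\<omega>. (stoch_integral Q T \<xi> f \<omega>)\<^sup>2) \<and>
           (\<integral>\<omega>. stoch_integral Q T \<xi> f \<omega> \<partial>Q) = 0 \<and>
           (\<integral>\<omega>. (stoch_integral Q T \<xi> f \<omega>)\<^sup>2 \<partial>Q)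
             \<le> \<kappa> Q * (LINT s:{0..T}|lborel. (f s)\<^sup>2)))"

definition kappa_star :: "'a measure set \<Rightarrow> ('a measure \<Rightarrow> real) \<Rightarrow> real" where
  "kappa_star \<Q> \<kappa> = (SUP Q\<in>\<Q>. \<kappa> Q)"

text \<open>The expectation under the law of \<open>y\<close> is an integral over paths on \<open>[0,T]\<close> with the
  \<open>\<sigma>\<close>-field generated by the coordinates; \<open>y\<^sub>0 = \<xi>\<^sub>0\<close>, which is immaterial
  because only increments of \<open>y\<close> are used.\<close>

definition observation_law ::
  "real \<Rightarrow> 'a measure \<Rightarrow> (real \<Rightarrow> 'a \<Rightarrow> real) \<Rightarrow> (real \<Rightarrow> real) \<Rightarrow> (real \<Rightarrow> real) measure" where
  "observation_law T Q \<xi> S =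
     distr Q (PiM {0..T} (\<lambda>_. borel))
       (\<lambda>\<omega>. \<lambda>t\<in>{0..T}. (LINT s:{0..t}|lborel. S s) + \<xi> t \<omega>)"


section \<open>Basis and coefficients\<close>

definition grid_basis :: "nat \<Rightarrow> (nat \<Rightarrow> real \<Rightarrow> real) \<Rightarrow> real \<Rightarrow> bool" where
  "grid_basis p \<phi> \<phi>s \<longleftrightarrow>
     (\<forall>j\<in>{1..p}. one_periodic (\<phi> j) \<and> L2_on 0 1 (\<phi> j)) \<and>
     (\<forall>i\<in>{1..p}. \<forall>j\<in>{1..p}.
        (\<Sum>l = 1..p. \<phi> i (real l / real p) * \<phi> j (real l / real p)) / real p
          = (if i = j then 1 else 0)) \<and>
     (\<forall>j\<in>{1..p}. \<forall>t\<in>{0..1}. \<bar>\<phi> j t\<bar> \<le> \<phi>s)"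

definition step_basis ::
  "nat \<Rightarrow> nat \<Rightarrow> (nat \<Rightarrow> real \<Rightarrow> real) \<Rightarrow> nat \<Rightarrow> real \<Rightarrow> real" where
  "step_basis n p \<phi> j t =
     (\<Sum>k = 1..n * p. \<phi> j (real k / real p) *
        indicator {(real k - 1) / real p <.. real k / real p} t)"

definition theta :: "nat \<Rightarrow> (nat \<Rightarrow> real \<Rightarrow> real) \<Rightarrow> (real \<Rightarrow> real) \<Rightarrow> nat \<Rightarrow> real" where
  "theta p \<phi> S j = (\<Sum>l = 1..p. S (real l / real p) * \<phi> j (real l / real p)) / real p"

definition theta_hat ::
  "nat \<Rightarrow> nat \<Rightarrow> (nat \<Rightarrow> real \<Rightarrow> real) \<Rightarrow> (real \<Rightarrow> real) \<Rightarrow> nat \<Rightarrow> real" where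
  "theta_hat n p \<phi> y j =
     (\<Sum>l = 1..n * p. \<phi> j (real l / real p) *
        (y (real l / real p) - y ((real l - 1) / real p))) / real n"

definition xi_coeff ::
  "nat \<Rightarrow> nat \<Rightarrow> (nat \<Rightarrow> real \<Rightarrow> real) \<Rightarrow> 'a measure \<Rightarrow> (real \<Rightarrow> 'a \<Rightarrow> real) \<Rightarrow> nat \<Rightarrow> 'a \<Rightarrow> real" where
  "xi_coeff n p \<phi> Q \<xi> j \<omega> = stoch_integral Q (real n) \<xi> (step_basis n p \<phi> j) \<omega> / sqrt (real n)"


section \<open>Conditions H1 and H2\<close>

definition cond_H1 :: "(nat \<Rightarrow> 'a measure set) \<Rightarrow> (nat \<Rightarrow> 'a measure \<Rightarrow> real) \<Rightarrow> bool" where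
  "cond_H1 \<Q> \<kappa> \<longleftrightarrow>
     (\<forall>n\<ge>1. bdd_above (\<kappa> n ` \<Q> n)) \<and>
     (\<forall>\<epsilon>>0. (\<lambda>n. real n powr (- \<epsilon>) * kappa_star (\<Q> n) (\<kappa> n)) \<longlonglongrightarrow> 0)"

text \<open>\<open>\<mu>\<close> is the centered, possibly degenerate Gaussian law on \<open>\<real>\<^sup>d\<close> with covariance matrix \<open>G\<close>:
  the law of \<open>A Z\<close> for a standard Gaussian vector \<open>Z\<close> and a matrix \<open>A\<close> with \<open>A A\<^sup>T = G\<close>.\<close>

definition centered_gaussian ::
  "nat \<Rightarrow> (nat \<Rightarrow> nat \<Rightarrow> real) \<Rightarrow> (nat \<Rightarrow> real) measure \<Rightarrow> bool" where
  "centered_gaussian d G \<mu> \<longleftrightarrow>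
     (\<exists>A :: nat \<Rightarrow> nat \<Rightarrow> real.
        (\<forall>i\<in>{1..d}. \<forall>j\<in>{1..d}. (\<Sum>k = 1..d. A i k * A j k) = G i j) \<and>
        \<mu> = distr (PiM {1..d} (\<lambda>_. density lborel (\<lambda>x. ennreal (std_normal_density x))))
              (PiM {1..d} (\<lambda>_. borel))
              (\<lambda>z. \<lambda>i\<in>{1..d}. \<Sum>k = 1..d. A i k * z k))"

text \<open>\<open>K\<close> is a regular conditional distribution of \<open>X\<close> given \<open>F\<close>.\<close>

definition regular_conditional_law ::
  "'a measure \<Rightarrow> 'a measure \<Rightarrow> 'b measure \<Rightarrow> ('a \<Rightarrow> 'b) \<Rightarrow> ('a \<Rightarrow> 'b measure) \<Rightarrow> bool" where
  "regular_conditional_law M F N X K \<longleftrightarrow>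
     X \<in> measurable M N \<and> K \<in> measurable F (prob_algebra N) \<and>
     (\<forall>B\<in>sets N. AE \<omega> in M.
        real_cond_exp M F (indicator (X -` B \<inter> space M)) \<omega> = measure (K \<omega>) B)"

definition cond_cov ::
  "'a measure \<Rightarrow> 'a measure \<Rightarrow> (nat \<Rightarrow> 'a \<Rightarrow> real) \<Rightarrow> 'a \<Rightarrow> nat \<Rightarrow> nat \<Rightarrow> real" where
  "cond_cov Q F X \<omega> i j = real_cond_exp Q F (\<lambda>\<omega>. X i \<omega> * X j \<omega>) \<omega>"

definition conditionally_gaussian ::
  "'a measure \<Rightarrow> 'a measure \<Rightarrow> nat \<Rightarrow> (nat \<Rightarrow> 'a \<Rightarrow> real) \<Rightarrow> bool" where
  "conditionally_gaussian Q F d X \<longleftrightarrow>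
     (\<exists>K. regular_conditional_law Q F (PiM {1..d} (\<lambda>_. borel)) (\<lambda>\<omega>. \<lambda>j\<in>{1..d}. X j \<omega>) K \<and>
        (AE \<omega> in Q. centered_gaussian d (cond_cov Q F X \<omega>) (K \<omega>)))"

text \<open>Matrices in \<open>Jordan_Normal_Form\<close> are indexed from 0.\<close>

definition lambda_max :: "nat \<Rightarrow> (nat \<Rightarrow> nat \<Rightarrow> real) \<Rightarrow> real" where
  "lambda_max d G = Max {x. eigenvalue (mat d d (\<lambda>(i, j). G (Suc i) (Suc j))) x}"

text \<open>As \<open>G\<close> is only defined \<open>Q\<close>-almost surely, the bound on the infimum over \<open>Q\<close> is read as an
  almost sure bound under each \<open>Q\<close>.\<close>

definition cond_H2 ::
  "nat \<Rightarrow> nat \<Rightarrow> nat \<Rightarrow> (nat \<Rightarrow> real \<Rightarrow> real) \<Rightarrow> (real \<Rightarrow> 'a \<Rightarrow> real) \<Rightarrow> 'a measure set \<Rightarrow> real \<Rightarrow> bool" where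
  "cond_H2 n p d \<phi> \<xi> \<Q> l \<longleftrightarrow>
     l > 0 \<and>
     (\<exists>F. \<forall>Q\<in>\<Q>. subalgebra Q F \<and> conditionally_gaussian Q F d (xi_coeff n p \<phi> Q \<xi>) \<and>
        (AE \<omega> in Q.
           let G = cond_cov Q F (xi_coeff n p \<phi> Q \<xi>) \<omega>
           in l \<le> (\<Sum>i = 1..d. G i i) - lambda_max d G))"


section \<open>The shrinkage estimator and its risk\<close>

definition shrink_const :: "nat \<Rightarrow> nat \<Rightarrow> real \<Rightarrow> real \<Rightarrow> real \<Rightarrow> real" where
  "shrink_const n d l r \<kappa>s = l / (real n * (r + sqrt (real d / real n * \<kappa>s)))"

definition theta_star ::
  "nat \<Rightarrow> nat \<Rightarrow> nat \<Rightarrow> (nat \<Rightarrow> real \<Rightarrow> real) \<Rightarrow> real \<Rightarrow> (real \<Rightarrow> real) \<Rightarrow> nat \<Rightarrow> real" where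
  "theta_star n p d \<phi> c y j =
     (1 - (if 1 \<le> j \<and> j \<le> d then c / dnorm d (theta_hat n p \<phi> y) else 0)) * theta_hat n p \<phi> y j"

definition risk_diff ::
  "nat \<Rightarrow> nat \<Rightarrow> nat \<Rightarrow> (nat \<Rightarrow> real \<Rightarrow> real) \<Rightarrow> real \<Rightarrow> (real \<Rightarrow> 'a \<Rightarrow> real)
     \<Rightarrow> 'a measure \<Rightarrow> (real \<Rightarrow> real) \<Rightarrow> real" where
  "risk_diff n p d \<phi> c \<xi> Q S =
     (\<integral>y. (dnorm d (\<lambda>j. theta_star n p d \<phi> c y j - theta p \<phi> S j))\<^sup>2
        \<partial>(observation_law (real n) Q \<xi> S)) -
     (\<integral>y. (dnorm d (\<lambda>j. theta_hat n p \<phi> y j - theta p \<phi> S j))\<^sup>2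
        \<partial>(observation_law (real n) Q \<xi> S))"

definition signal_class :: "real \<Rightarrow> real \<Rightarrow> (real \<Rightarrow> real) set" where
  "signal_class L r =
     {S. one_periodic S \<and> L2_on 0 1 S \<and> lipschitz_on L {0..1} S \<and> L2_norm01 S \<le> r}"

end

theory Submission
  imports Defs
begin

text \<open>
  On the first \<open>d\<close> coordinates the estimator is \<open>X = b + Z\<close>, where \<open>b\<^sub>j = (S, \<psi>\<^sub>j)\<close> and the noise
  \<open>Z\<close> is, given the \<open>\<sigma>\<close>-field of condition \<open>H2\<close>, centered Gaussian with covariance \<open>G / n\<close>.
  Expanding the square, shrinking \<open>X\<close> by \<open>c X / |X|\<close> changes the risk by at most
  \<open>c\<^sup>2 - 2 c E[(X, Z) / |X|] + 2 c |b - \<theta>|\<close>.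
  Stein's identity for the vector field \<open>x / sqrt (|x|\<^sup>2 + \<epsilon>)\<close>, whose regularization \<open>\<epsilon>\<close> avoids the
  singularity at the origin, gives
  \<open>E[(X, Z) / sqrt (|X|\<^sup>2 + \<epsilon>)] \<ge> (l / n) E[1 / sqrt (|X|\<^sup>2 + \<epsilon>)]\<close>, because the trace of \<open>G\<close> exceeds
  its largest eigenvalue by at least \<open>l\<close>. By Jensen's inequality and \<open>\<epsilon> \<rightarrow> 0\<close> the gain
  \<open>E[(X, Z) / |X|]\<close> is at least \<open>(l / n) / (r + sqrt (d \<kappa> / n)) = c\<close>: Bessel's inequality bounds \<open>|b|\<close>
  by \<open>r\<close>, and \<open>E |Z|\<^sup>2 \<le> d \<kappa> / n\<close>. The Lipschitz condition bounds \<open>|b - \<theta>|\<close>.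
\<close>

section \<open>Stein's identity for Gaussian vectors\<close>

text \<open>The covariance \<open>G\<close> is random and may be singular, so there is no
  conditional density to differentiate. Stein's identity is therefore applied to the independent
  standard normal coordinates behind a factorization \<open>G = A A^T\<close>, one coordinate at a
  time. The resulting derivatives add up to \<open>tr G / s - X^T G X / s^3\<close>, times the noise
  scale, where \<open>s\<close> is the regularized norm of \<open>X\<close>. The second term is at
  most \<open>lambda_max G / s\<close>, and this is how the trace minus the largest eigenvalue
  enters. With \<open>\<sigma> = 1 / sqrt n\<close>, one factor \<open>\<sigma>\<close> comes from
  differentiating \<open>b + \<sigma> z\<close> and a second one from writing the noise as
  \<open>\<sigma>\<close> times the normalized coefficients; together they turn \<open>l\<close>
  into \<open>l / n\<close>. If \<open>m\<close> is the lower bound for the gain, the unbiased part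
  of the risk change is at most \<open>c^2 - 2 c m\<close>. Its minimum over \<open>c\<close> is
  attained at \<open>c = m\<close>, which is exactly the prescribed constant and leaves
  \<open>- c^2\<close>. The Gaussian estimate holds under the conditional law for almost every
  outcome. It is carried over to \<open>Q\<close> through nonnegative integrals, which is possible
  because the regularized integrand is bounded below.\<close>

abbreviation std_gaussian :: "real measure" where
  "std_gaussian \<equiv> density lborel (\<lambda>x. ennreal (std_normal_density x))"

lemma prob_space_std_gaussian: "prob_space std_gaussian"
  using prob_space_normal_density[of 1 0] by simp

lemma std_normal_density_has_derivative:
  "(std_normal_density has_real_derivative - x * std_normal_density x) (at x)"
  unfolding std_normal_density_def[abs_def]
  by (auto intro!: derivative_eq_intros simp: field_simps power2_eq_square)

lemma std_normal_density_tendsto: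
  shows "(std_normal_density \<longlongrightarrow> 0) at_top" and "(std_normal_density \<longlongrightarrow> 0) at_bot"
  unfolding std_normal_density_def[abs_def] by real_asymp+

lemma integrable_std_gaussian_id: "integrable std_gaussian (\<lambda>x. x)"
  using integrable_std_normal_moment[of 1]
  by (subst integrable_density) (auto simp: mult.commute)

text \<open>Integration by parts: the product of \<open>g\<close> with the normal density has
  derivative \<open>g' x - x * g x\<close> times the density, and it vanishes at both ends because
  \<open>g\<close> is bounded. The common bound \<open>B\<close> also makes the two integrals exist
  separately.\<close>

lemma stein_std_gaussian:
  fixes g g' :: "real \<Rightarrow> real"
  assumes deriv: "\<And>x. (g has_real_derivative g' x) (at x)"
    and cont: "continuous_on UNIV g'"
    and bound: "\<And>x. \<bar>g x\<bar> \<le> B" "\<And>x. \<bar>g' x\<bar> \<le> B"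
  shows "(\<integral>x. x * g x \<partial>std_gaussian) = (\<integral>x. g' x \<partial>std_gaussian)"
proof -
  let ?D = std_normal_density
  have cont_g: "continuous_on UNIV g"
    using deriv by (meson DERIV_continuous_on has_field_derivative_at_within)
  have [measurable]: "g \<in> borel_measurable borel" "g' \<in> borel_measurable borel"
    using cont cont_g by (auto intro: borel_measurable_continuous_onI)
  have i1: "integrable lborel (\<lambda>x. ?D x * g' x)"
  proof (rule Bochner_Integration.integrable_bound)
    show "integrable lborel (\<lambda>x. B * ?D x)" by simp
    show "AE x in lborel. norm (?D x * g' x) \<le> norm (B * ?D x)"
      using bound(2) by (auto simp: abs_mult mult.commute intro!: mult_right_mono order_trans[OF bound(2) abs_ge_self])
  qed simp
  have i2: "integrable lborel (\<lambda>x. ?D x * (x * g x))"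
  proof (rule Bochner_Integration.integrable_bound)
    show "integrable lborel (\<lambda>x. B * (?D x * \<bar>x\<bar> ^ 1))"
      by (intro integrable_mult_right integrable_std_normal_moment_abs)
    show "AE x in lborel. norm (?D x * (x * g x)) \<le> norm (B * (?D x * \<bar>x\<bar> ^ 1))"
      by (auto simp: abs_mult mult_ac intro!: mult_left_mono mult_right_mono order_trans[OF bound(1) abs_ge_self])
  qed simp
  have lim: "((\<lambda>x. g x * ?D x) \<longlongrightarrow> 0) F" if "(?D \<longlongrightarrow> 0) F" for F
  proof (rule Lim_null_comparison[where g = "\<lambda>x. B * ?D x"])
    show "\<forall>\<^sub>F x in F. norm (g x * ?D x) \<le> B * ?D x"
      by (intro always_eventually allI) (auto simp: abs_mult intro!: mult_right_mono bound)
    show "((\<lambda>x. B * ?D x) \<longlongrightarrow> 0) F"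
      using tendsto_mult_left[OF that, of B] by simp
  qed
  have "(LBINT x=-\<infinity>..\<infinity>. ?D x * g' x - ?D x * (x * g x)) = 0 - 0"
  proof (rule interval_integral_FTC_integrable[where F = "\<lambda>x. g x * ?D x"])
    show "((\<lambda>x. g x * ?D x) has_vector_derivative ?D x * g' x - ?D x * (x * g x)) (at x)" for x
      unfolding has_real_derivative_iff_has_vector_derivative[symmetric]
      by (rule DERIV_cong[OF DERIV_mult[OF deriv std_normal_density_has_derivative]]) (simp add: algebra_simps)
    show "isCont (\<lambda>x. ?D x * g' x - ?D x * (x * g x)) x" for x
      using cont cont_g std_normal_density_has_derivative[THEN DERIV_isCont]
      by (auto simp: continuous_on_eq_continuous_at intro!: continuous_intros)
    show "set_integrable lborel (einterval (- \<infinity>) \<infinity>) (\<lambda>x. ?D x * g' x - ?D x * (x * g x))"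
      using i1 i2 by (simp add: set_integrable_def)
    show "(((\<lambda>x. g x * ?D x) \<circ> real_of_ereal) \<longlongrightarrow> 0) (at_right (- \<infinity>))"
      using lim[OF std_normal_density_tendsto(2)] by (simp add: ereal_tendsto_simps)
    show "(((\<lambda>x. g x * ?D x) \<circ> real_of_ereal) \<longlongrightarrow> 0) (at_left \<infinity>)"
      using lim[OF std_normal_density_tendsto(1)] by (simp add: ereal_tendsto_simps)
  qed simp
  hence "(\<integral>x. ?D x * g' x - ?D x * (x * g x) \<partial>lborel) = 0"
    by (simp add: interval_lebesgue_integral_def set_lebesgue_integral_def)
  thus ?thesis
    using i1 i2 by (simp add: integral_density)
qed

lemma integrable_PiM_gaussian_coordinate:
  assumes "k \<in> I"
  shows "integrable (PiM I (\<lambda>_. std_gaussian)) (\<lambda>z. z k)"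
proof -
  have d: "distr (PiM I (\<lambda>_. std_gaussian)) std_gaussian (\<lambda>z. z k) = std_gaussian"
    using distr_PiM_component[OF prob_space_std_gaussian assms] .
  have "integrable (distr (PiM I (\<lambda>_. std_gaussian)) std_gaussian (\<lambda>z. z k)) (\<lambda>x. x)"
    unfolding d by (rule integrable_std_gaussian_id)
  thus ?thesis
    using assms by (subst (asm) integrable_distr_eq) auto
qed

text \<open>Fubini's theorem isolates coordinate \<open>k\<close>; with the other coordinates
  frozen, the one-dimensional identity applies along the line \<open>z(k := x)\<close>. The product
  \<open>z k * g z\<close> is dominated by a multiple of \<open>\<bar>z k\<bar>\<close>.\<close>

lemma stein_PiM_gaussian:
  fixes g g' :: "(nat \<Rightarrow> real) \<Rightarrow> real"
  assumes I: "finite I" "k \<in> I"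
    and meas [measurable]: "g \<in> borel_measurable (PiM I (\<lambda>_. std_gaussian))"
      "g' \<in> borel_measurable (PiM I (\<lambda>_. std_gaussian))"
    and deriv: "\<And>z x. ((\<lambda>u. g (z(k := u))) has_real_derivative g' (z(k := x))) (at x)"
    and cont: "\<And>z. continuous_on UNIV (\<lambda>x. g' (z(k := x)))"
    and bound: "\<And>z. \<bar>g z\<bar> \<le> B" "\<And>z. \<bar>g' z\<bar> \<le> B"
  shows "integrable (PiM I (\<lambda>_. std_gaussian)) (\<lambda>z. z k * g z)"
    and "integrable (PiM I (\<lambda>_. std_gaussian)) g'"
    and "(\<integral>z. z k * g z \<partial>PiM I (\<lambda>_. std_gaussian)) = (\<integral>z. g' z \<partial>PiM I (\<lambda>_. std_gaussian))"
proof -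
  let ?P = "PiM I (\<lambda>_. std_gaussian)"
  interpret G: prob_space std_gaussian by (rule prob_space_std_gaussian)
  interpret product_prob_space "\<lambda>_. std_gaussian" I by unfold_locales
  interpret P: prob_space ?P by (rule prob_space_PiM) (rule prob_space_std_gaussian)
  have [measurable]: "(\<lambda>z. z k) \<in> borel_measurable ?P"
    using integrable_PiM_gaussian_coordinate[OF I(2)] by auto
  show int: "integrable ?P (\<lambda>z. z k * g z)"
  proof (rule Bochner_Integration.integrable_bound)
    show "integrable ?P (\<lambda>z. B * z k)"
      using integrable_PiM_gaussian_coordinate[OF I(2)] by simp
    have "\<bar>z k * g z\<bar> \<le> \<bar>B * z k\<bar>" for z
      unfolding abs_mult by (subst mult.commute)
         (intro mult_right_mono order_trans[OF bound(1) abs_ge_self] abs_ge_zero)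
    thus "AE z in ?P. norm (z k * g z) \<le> norm (B * z k)"
      by simp
  qed simp
  show int': "integrable ?P g'"
    by (rule P.integrable_const_bound[where B = B]) (use bound in auto)
  have eq: "I = insert k (I - {k})" using I by auto
  have fin: "finite (I - {k})" "k \<notin> I - {k}" using I by auto
  have "(\<integral>z. z k * g z \<partial>?P) =
      (\<integral>z. (\<integral>x. x * g (z(k := x)) \<partial>std_gaussian) \<partial>PiM (I - {k}) (\<lambda>_. std_gaussian))"
    using product_integral_insert[OF fin, folded eq, OF int] by simp
  also have "\<dots> = (\<integral>z. (\<integral>x. g' (z(k := x)) \<partial>std_gaussian) \<partial>PiM (I - {k}) (\<lambda>_. std_gaussian))"
    by (intro Bochner_Integration.integral_cong refl stein_std_gaussian[where B = B] deriv cont bound)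
  also have "\<dots> = (\<integral>z. g' z \<partial>?P)"
    using product_integral_insert[OF fin, folded eq, OF int'] by simp
  finally show "(\<integral>z. z k * g z \<partial>?P) = (\<integral>z. g' z \<partial>?P)" .
qed

text \<open>Let \<open>z = A N\<close> with \<open>N\<close> standard normal and
  \<open>A A^T = G\<close>. Then the inner product of \<open>X\<close> and \<open>z\<close>, divided
  by \<open>s\<close>, is the sum of \<open>N_k u_k / s\<close> with \<open>u = A^T X\<close>.
  Stein's identity replaces this sum by \<open>\<sigma> (tr G / s - |u|^2 / s^3)\<close>, and
  \<open>|u|^2 = X^T G X\<close> is at most \<open>\<Lambda> s^2\<close>. What remains is at least
  \<open>\<sigma> l / s\<close>. The argument uses only a factor of \<open>G\<close>, never an
  inverse, so singular covariances are covered.\<close>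

lemma gaussian_shrinkage_inequality:
  fixes d :: nat and G :: "nat \<Rightarrow> nat \<Rightarrow> real" and b :: "nat \<Rightarrow> real" and \<sigma> \<epsilon> :: real
  defines "X \<equiv> \<lambda>z i. b i + \<sigma> * z i"
  defines "s \<equiv> \<lambda>z. sqrt ((\<Sum>i = 1..d. (X z i)\<^sup>2) + \<epsilon>)"
  assumes gauss: "centered_gaussian d G \<mu>"
    and rayleigh: "\<And>x. (\<Sum>i = 1..d. \<Sum>j = 1..d. G i j * x i * x j) \<le> \<Lambda> * (\<Sum>i = 1..d. (x i)\<^sup>2)"
    and l: "l \<le> (\<Sum>i = 1..d. G i i) - \<Lambda>" and \<Lambda>: "0 \<le> \<Lambda>" and \<epsilon>: "0 < \<epsilon>" and \<sigma>: "0 \<le> \<sigma>"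
  shows "integrable \<mu> (\<lambda>z. ((\<Sum>i = 1..d. X z i * z i) - \<sigma> * l) / s z)"
    and "0 \<le> (\<integral>z. ((\<Sum>i = 1..d. X z i * z i) - \<sigma> * l) / s z \<partial>\<mu>)"
proof -
  let ?I = "{1..d}"
  let ?P = "PiM ?I (\<lambda>_. std_gaussian)" and ?N = "PiM ?I (\<lambda>_. borel :: real measure)"
  obtain A where A: "\<And>i j. i \<in> ?I \<Longrightarrow> j \<in> ?I \<Longrightarrow> (\<Sum>k = 1..d. A i k * A j k) = G i j"
    and \<mu>: "\<mu> = distr ?P ?N (\<lambda>z. \<lambda>i\<in>?I. \<Sum>k = 1..d. A i k * z k)"
    using gauss unfolding centered_gaussian_def by blast
  interpret P: prob_space ?P by (rule prob_space_PiM) (rule prob_space_std_gaussian)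
  have coord [measurable]: "(\<lambda>z. z k) \<in> borel_measurable ?P" if "k \<in> ?I" for k
    using integrable_PiM_gaussian_coordinate[OF that] by auto
  define w where "w = (\<lambda>z i. \<Sum>k = 1..d. A i k * z k)"
  define Y where "Y = (\<lambda>z. X (w z))"
  define S where "S = (\<lambda>z. s (w z))"
  define u where "u = (\<lambda>k z. \<Sum>i = 1..d. A i k * Y z i)"
  define v where "v = (\<lambda>k. \<Sum>i = 1..d. (A i k)\<^sup>2)"
  define a where "a = (\<lambda>k. \<Sum>i = 1..d. \<bar>A i k\<bar>)"
  define g where "g = (\<lambda>k z. u k z / S z)"
  \<comment> \<open>The partial derivative of \<open>g k\<close> in coordinate \<open>k\<close>, by
    the quotient rule: along that coordinate \<open>u k\<close> has slope
    \<open>\<sigma> * v k\<close> and \<open>S\<close> has slope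
    \<open>\<sigma> * u k / S\<close>.\<close>
  define g' where "g' = (\<lambda>k z. \<sigma> * (v k / S z - (u k z)\<^sup>2 / (S z) ^ 3))"
  have s2: "(s z)\<^sup>2 = (\<Sum>i = 1..d. (X z i)\<^sup>2) + \<epsilon>" for z
    unfolding s_def using \<epsilon> by (intro real_sqrt_pow2 add_nonneg_nonneg sum_nonneg) auto
  have s_ge: "sqrt \<epsilon> \<le> s z" for z
    unfolding s_def by (intro real_sqrt_le_mono) (simp add: sum_nonneg)
  have s_pos: "0 < s z" for z
    using s_ge[of z] \<epsilon> by (meson less_le_trans real_sqrt_gt_zero)
  have X_le: "\<bar>X z i\<bar> \<le> s z" if "i \<in> ?I" for z i
  proof -
    have "(X z i)\<^sup>2 \<le> (\<Sum>i = 1..d. (X z i)\<^sup>2)"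
      using that by (intro member_le_sum) auto
    hence "(X z i)\<^sup>2 \<le> (s z)\<^sup>2" using s2[of z] \<epsilon> by linarith
    thus ?thesis using s_pos[of z] by (simp add: abs_le_square_iff[symmetric])
  qed
  have S_pos: "0 < S z" and S_ge: "sqrt \<epsilon> \<le> S z" for z
    unfolding S_def by (rule s_pos s_ge)+
  have S2: "(S z)\<^sup>2 = (\<Sum>i = 1..d. (Y z i)\<^sup>2) + \<epsilon>" for z
    unfolding S_def Y_def by (rule s2)
  have u_le: "\<bar>u k z\<bar> \<le> a k * S z" for k z
  proof -
    have "\<bar>u k z\<bar> \<le> (\<Sum>i = 1..d. \<bar>A i k * Y z i\<bar>)" unfolding u_def by (rule sum_abs)
    also have "\<dots> \<le> (\<Sum>i = 1..d. \<bar>A i k\<bar> * S z)"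
      unfolding abs_mult Y_def S_def by (intro sum_mono mult_left_mono X_le) auto
    finally show ?thesis by (simp add: a_def sum_distrib_right)
  qed
  have a_nn: "0 \<le> a k" and v_nn: "0 \<le> v k" for k
    unfolding a_def v_def by (auto intro: sum_nonneg)
  have g_bound: "\<bar>g k z\<bar> \<le> a k" for k z
    using u_le[of k z] S_pos[of z] by (simp add: g_def field_simps)
  \<comment> \<open>The bound \<open>a k\<close> on \<open>g k\<close> is free of
    \<open>\<epsilon>\<close>, but the derivative grows like \<open>1 / S\<close> near the origin.
    Only \<open>S \<ge> sqrt \<epsilon>\<close> keeps it bounded, as Stein's identity
    requires.\<close>
  have g'_bound: "\<bar>g' k z\<bar> \<le> \<sigma> * (v k / sqrt \<epsilon> + (a k)\<^sup>2 / sqrt \<epsilon>)" for k z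
  proof -
    have 1: "v k / S z \<le> v k / sqrt \<epsilon>"
      using S_ge[of z] v_nn \<epsilon> by (intro divide_left_mono) (auto intro!: mult_pos_pos S_pos)
    have "(u k z)\<^sup>2 \<le> (a k * S z)\<^sup>2"
      using u_le[of k z] by (simp add: abs_le_square_iff[symmetric] abs_mult a_nn S_pos less_imp_le)
    hence "(u k z)\<^sup>2 / (S z) ^ 3 \<le> (a k * S z)\<^sup>2 / (S z) ^ 3"
      using S_pos[of z] by (intro divide_right_mono) auto
    also have "\<dots> = (a k)\<^sup>2 / S z"
      using S_pos[of z] by (simp add: field_simps power2_eq_square power3_eq_cube)
    also have "\<dots> \<le> (a k)\<^sup>2 / sqrt \<epsilon>"
      using S_ge[of z] \<epsilon> by (intro divide_left_mono) (auto intro!: mult_pos_pos S_pos)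
    finally have 2: "(u k z)\<^sup>2 / (S z) ^ 3 \<le> (a k)\<^sup>2 / sqrt \<epsilon>" .
    have 3: "0 \<le> v k / S z" "0 \<le> (u k z)\<^sup>2 / (S z) ^ 3"
      using S_pos[of z] v_nn by auto
    have "\<bar>g' k z\<bar> = \<sigma> * \<bar>v k / S z - (u k z)\<^sup>2 / (S z) ^ 3\<bar>"
      using \<sigma> by (simp add: g'_def abs_mult)
    also have "\<dots> \<le> \<sigma> * (v k / sqrt \<epsilon> + (a k)\<^sup>2 / sqrt \<epsilon>)"
      using \<sigma> 1 2 3 by (intro mult_left_mono) linarith+
    finally show ?thesis .
  qed
  have dw: "((\<lambda>x. w (z(k := x)) i) has_real_derivative A i k) (at x)" if "k \<in> ?I" for z k i x
  proof -
    have eq: "w (z(k := x)) i = A i k * x + (\<Sum>m \<in> ?I - {k}. A i m * z m)" for x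
      unfolding w_def using that by (subst sum.remove[of _ k]) (auto intro!: sum.cong)
    show ?thesis unfolding eq by (auto intro!: derivative_eq_intros)
  qed
  have dY: "((\<lambda>x. Y (z(k := x)) i) has_real_derivative \<sigma> * A i k) (at x)" if "k \<in> ?I" for z k i x
    unfolding Y_def X_def by (auto intro!: derivative_eq_intros dw[OF that])
  have du: "((\<lambda>x. u k (z(k := x))) has_real_derivative \<sigma> * v k) (at x)" if "k \<in> ?I" for z k x
    unfolding u_def v_def sum_distrib_left
    by (rule derivative_eq_intros dY[OF that] refl | simp add: power2_eq_square mult_ac)+
  have dS: "((\<lambda>x. S (z(k := x))) has_real_derivative \<sigma> * u k (z(k := x)) / S (z(k := x))) (at x)"
    if "k \<in> ?I" for z k x
  proof -
    let ?q = "\<lambda>x. (\<Sum>i = 1..d. (Y (z(k := x)) i)\<^sup>2) + \<epsilon>"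
    have q: "S (z(k := x)) = sqrt (?q x)" for x
      unfolding S_def s_def Y_def by simp
    have pos: "?q x > 0" using S2[of "z(k := x)"] S_pos[of "z(k := x)"]
      by (metis zero_less_power)
    have dq: "(?q has_real_derivative 2 * \<sigma> * u k (z(k := x))) (at x)"
      unfolding u_def sum_distrib_left
      by (rule derivative_eq_intros dY[OF that] refl | simp add: mult_ac)+
    show ?thesis unfolding q
      by (rule DERIV_cong[OF DERIV_chain2[OF DERIV_real_sqrt[OF pos] dq]]) (simp add: field_simps)
  qed
  have dg: "((\<lambda>x. g k (z(k := x))) has_real_derivative g' k (z(k := x))) (at x)" if "k \<in> ?I" for z k x
    unfolding g_def g'_def
    by (rule DERIV_cong[OF DERIV_divide[OF du[OF that] dS[OF that]]])
       (use S_pos[of "z(k := x)"] in \<open>auto simp: field_simps power2_eq_square power3_eq_cube\<close>)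
  have cg': "continuous_on UNIV (\<lambda>x. g' k (z(k := x)))" if "k \<in> ?I" for z k
  proof -
    have "continuous_on UNIV (\<lambda>x. S (z(k := x)))" "continuous_on UNIV (\<lambda>x. u k (z(k := x)))"
      by (rule DERIV_continuous_on[OF has_field_derivative_at_within], rule dS[OF that] du[OF that])+
    moreover have "S z \<noteq> 0" for z using S_pos[of z] by simp
    ultimately show ?thesis unfolding g'_def
      by (intro continuous_intros) auto
  qed
  have w_meas [measurable]: "(\<lambda>z. w z i) \<in> borel_measurable ?P" for i
    unfolding w_def by measurable
  have Y_meas [measurable]: "(\<lambda>z. Y z i) \<in> borel_measurable ?P" for i
    unfolding Y_def X_def by measurable
  have S_meas [measurable]: "S \<in> borel_measurable ?P"
  proof -
    have eq: "S = (\<lambda>z. sqrt ((\<Sum>i = 1..d. (Y z i)\<^sup>2) + \<epsilon>))"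
      by (simp add: S_def s_def Y_def fun_eq_iff)
    show ?thesis unfolding eq by measurable
  qed
  have gm [measurable]: "g k \<in> borel_measurable ?P" "g' k \<in> borel_measurable ?P" for k
    unfolding g_def g'_def u_def by measurable
  have stein: "integrable ?P (\<lambda>z. z k * g k z)" "integrable ?P (g' k)"
      "(\<integral>z. z k * g k z \<partial>?P) = (\<integral>z. g' k z \<partial>?P)" if "k \<in> ?I" for k
  proof -
    let ?B = "a k + \<sigma> * (v k / sqrt \<epsilon> + (a k)\<^sup>2 / sqrt \<epsilon>)"
    have b: "\<bar>g k z\<bar> \<le> ?B" "\<bar>g' k z\<bar> \<le> ?B" for z
      using g_bound[of k z] g'_bound[of k z] a_nn[of k] v_nn[of k] \<sigma> \<epsilon> by (auto intro: order_trans)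
    note st = stein_PiM_gaussian[of ?I k "g k" "g' k" ?B, OF finite_atLeastAtMost that gm dg[OF that] cg'[OF that] b]
    show "integrable ?P (\<lambda>z. z k * g k z)" "integrable ?P (g' k)"
      "(\<integral>z. z k * g k z \<partial>?P) = (\<integral>z. g' k z \<partial>?P)"
      by (rule st)+
  qed
  have int_S: "integrable ?P (\<lambda>z. 1 / S z)"
  proof (rule P.integrable_const_bound[where B = "1 / sqrt \<epsilon>"])
    show "AE z in ?P. norm (1 / S z) \<le> 1 / sqrt \<epsilon>"
      using S_pos S_ge \<epsilon> by (intro always_eventually allI) (auto simp: less_imp_le intro!: divide_left_mono)
  qed measurable
  let ?h = "\<lambda>z. ((\<Sum>i = 1..d. X z i * z i) - \<sigma> * l) / s z"
  \<comment> \<open>The law \<open>\<mu>\<close> lives on functions restricted to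
    \<open>{1..d}\<close>, whereas \<open>w z\<close> is defined for all indices. The two agree in
    \<open>s\<close> because only indices in \<open>{1..d}\<close> are read.\<close>
  have s_restr: "s (\<lambda>i\<in>?I. w z i) = S z" for z
    unfolding S_def s_def by (intro arg_cong[where f = sqrt] arg_cong2[where f = "(+)"] sum.cong) (auto simp: X_def)
  have h_eq: "?h (\<lambda>i\<in>?I. w z i) = (\<Sum>k = 1..d. z k * g k z) - \<sigma> * l * (1 / S z)" for z
  proof -
    have "(\<Sum>i = 1..d. X (\<lambda>i\<in>?I. w z i) i * (\<lambda>i\<in>?I. w z i) i) = (\<Sum>i = 1..d. Y z i * w z i)"
      by (intro sum.cong) (auto simp: X_def Y_def)
    also have "\<dots> = (\<Sum>i = 1..d. \<Sum>k = 1..d. z k * (A i k * Y z i))"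
      by (simp add: w_def sum_distrib_left mult_ac)
    also have "\<dots> = (\<Sum>k = 1..d. z k * u k z)"
      by (subst sum.swap) (simp add: u_def sum_distrib_left)
    finally show ?thesis
      unfolding s_restr by (simp add: g_def diff_divide_distrib sum_divide_distrib)
  qed
  have wm: "(\<lambda>z. \<lambda>i\<in>?I. w z i) \<in> measurable ?P ?N"
    by (intro measurable_restrict w_meas)
  have hm: "?h \<in> borel_measurable ?N"
    unfolding s_def X_def by measurable
  have \<mu>': "\<mu> = distr ?P ?N (\<lambda>z. \<lambda>i\<in>?I. w z i)"
    unfolding \<mu> w_def ..
  have int_h: "integrable ?P (\<lambda>z. ?h (\<lambda>i\<in>?I. w z i))"
    unfolding h_eq using stein(1) int_S by (intro Bochner_Integration.integrable_diff Bochner_Integration.integrable_sum integrable_mult_right) auto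
  thus "integrable \<mu> ?h"
    unfolding \<mu>' by (subst integrable_distr_eq[OF wm hm])
  have sum_v: "(\<Sum>k = 1..d. v k) = (\<Sum>i = 1..d. G i i)"
    unfolding v_def by (subst sum.swap) (simp add: A[symmetric] power2_eq_square)
  \<comment> \<open>This is \<open>|A^T Y|^2 = Y^T G Y\<close>, followed by the Rayleigh bound.
    Adding \<open>\<epsilon>\<close> to \<open>|Y|^2\<close> does not decrease the right-hand side
    since \<open>\<Lambda> \<ge> 0\<close>.\<close>
  have sum_u: "(\<Sum>k = 1..d. (u k z)\<^sup>2) \<le> \<Lambda> * (S z)\<^sup>2" for z
  proof -
    have "(\<Sum>k = 1..d. (u k z)\<^sup>2) = (\<Sum>k = 1..d. \<Sum>i = 1..d. \<Sum>j = 1..d. A i k * A j k * Y z i * Y z j)"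
      by (simp add: u_def power2_eq_square sum_product mult_ac)
    also have "\<dots> = (\<Sum>i = 1..d. \<Sum>k = 1..d. \<Sum>j = 1..d. A i k * A j k * Y z i * Y z j)"
      by (rule sum.swap)
    also have "\<dots> = (\<Sum>i = 1..d. \<Sum>j = 1..d. \<Sum>k = 1..d. A i k * A j k * Y z i * Y z j)"
      by (rule sum.cong[OF refl], rule sum.swap)
    also have "\<dots> = (\<Sum>i = 1..d. \<Sum>j = 1..d. G i j * Y z i * Y z j)"
      by (simp add: A[symmetric] sum_distrib_right)
    also have "\<dots> \<le> \<Lambda> * (\<Sum>i = 1..d. (Y z i)\<^sup>2)" by (rule rayleigh)
    also have "\<dots> \<le> \<Lambda> * (S z)\<^sup>2"
      unfolding S2 using \<Lambda> \<epsilon> by (intro mult_left_mono) auto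
    finally show ?thesis .
  qed
  have pt: "\<sigma> * l * (1 / S z) \<le> (\<Sum>k = 1..d. g' k z)" for z
  proof -
    have "(\<Sum>k = 1..d. (u k z)\<^sup>2) / (S z) ^ 3 \<le> \<Lambda> * (S z)\<^sup>2 / (S z) ^ 3"
      using S_pos[of z] by (intro divide_right_mono sum_u) auto
    also have "\<dots> = \<Lambda> / S z"
      using S_pos[of z] by (simp add: field_simps power2_eq_square power3_eq_cube)
    finally have 1: "(\<Sum>k = 1..d. (u k z)\<^sup>2) / (S z) ^ 3 \<le> \<Lambda> / S z" .
    have "l / S z \<le> ((\<Sum>i = 1..d. G i i) - \<Lambda>) / S z"
      using S_pos[of z] l by (intro divide_right_mono) auto
    also have "\<dots> = (\<Sum>k = 1..d. v k) / S z - \<Lambda> / S z"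
      unfolding sum_v by (simp add: diff_divide_distrib)
    also have "\<dots> \<le> (\<Sum>k = 1..d. v k) / S z - (\<Sum>k = 1..d. (u k z)\<^sup>2) / (S z) ^ 3"
      using 1 by simp
    finally have "\<sigma> * (l / S z) \<le> \<sigma> * \<dots>" using \<sigma> by (rule mult_left_mono)
    also have "\<dots> = (\<Sum>k = 1..d. g' k z)"
      by (simp add: g'_def sum_distrib_left sum_subtractf sum_divide_distrib right_diff_distrib)
    finally show ?thesis by simp
  qed
  have int_S': "integrable ?P (\<lambda>z. \<sigma> * l * (1 / S z))"
    using int_S by (rule integrable_mult_right)
  have int_g: "integrable ?P (\<lambda>z. \<Sum>k = 1..d. z k * g k z)"
    using stein(1) by (rule Bochner_Integration.integrable_sum)
  have "(\<integral>z. \<sigma> * l * (1 / S z) \<partial>?P) \<le> (\<integral>z. (\<Sum>k = 1..d. g' k z) \<partial>?P)"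
    by (intro integral_mono pt int_S' Bochner_Integration.integrable_sum stein(2))
  also have "\<dots> = (\<integral>z. (\<Sum>k = 1..d. z k * g k z) \<partial>?P)"
    using stein by (simp add: Bochner_Integration.integral_sum)
  finally have "0 \<le> (\<integral>z. (\<Sum>k = 1..d. z k * g k z) - \<sigma> * l * (1 / S z) \<partial>?P)"
    using Bochner_Integration.integral_diff[OF int_g int_S'] by linarith
  thus "0 \<le> (\<integral>z. ?h z \<partial>\<mu>)"
    unfolding \<mu>' by (subst integral_distr[OF wm hm]) (simp only: h_eq)
qed

section \<open>Rayleigh quotients\<close>

definition quad_form :: "nat \<Rightarrow> (nat \<Rightarrow> nat \<Rightarrow> real) \<Rightarrow> (nat \<Rightarrow> real) \<Rightarrow> real" where
  "quad_form d G x = (\<Sum>i = 1..d. \<Sum>j = 1..d. G i j * x i * x j)"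

text \<open>Vectors are functions on all of \<open>nat\<close>, so the coordinates outside
  \<open>{1..d}\<close> are pinned to zero. The sphere is then a closed subset of a product of
  compact sets, and Tychonoff's theorem applies.\<close>

lemma compact_coordinate_sphere:
  "compact {x :: nat \<Rightarrow> real. (\<forall>i. i \<notin> {1..d} \<longrightarrow> x i = 0) \<and> (\<Sum>i = 1..d. (x i)\<^sup>2) = 1}"
    (is "compact ?K")
proof -
  let ?C = "PiE UNIV (\<lambda>i. if i \<in> {1..d} then {-1..1} else {0 :: real})"
  have "compactin (product_topology (\<lambda>_ :: nat. euclidean :: real topology) UNIV) ?C"
    by (subst compactin_PiE) (auto simp: compactin_euclidean_iff)
  hence "compact ?C"
    by (simp add: euclidean_product_topology compactin_euclidean_iff)
  moreover have "closed {x :: nat \<Rightarrow> real. (\<Sum>i = 1..d. (x i)\<^sup>2) = 1}"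
    by (intro closed_Collect_eq continuous_intros continuous_on_product_coordinates)
  ultimately have "compact (?C \<inter> {x. (\<Sum>i = 1..d. (x i)\<^sup>2) = 1})"
    by (rule compact_Int_closed)
  also have "?C \<inter> {x. (\<Sum>i = 1..d. (x i)\<^sup>2) = 1} = ?K"
  proof (intro equalityI subsetI)
    fix x assume "x \<in> ?K"
    hence x: "\<forall>i. i \<notin> {1..d} \<longrightarrow> x i = 0" "(\<Sum>i = 1..d. (x i)\<^sup>2) = 1" by auto
    have "\<bar>x i\<bar> \<le> 1" if "i \<in> {1..d}" for i
    proof -
      have "(x i)\<^sup>2 \<le> (\<Sum>i = 1..d. (x i)\<^sup>2)"
        using that by (intro member_le_sum) auto
      thus ?thesis using x(2) by (simp add: abs_square_le_1)
    qed
    thus "x \<in> ?C \<inter> {x. (\<Sum>i = 1..d. (x i)\<^sup>2) = 1}"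
      using x by (auto simp: abs_le_iff minus_le_iff)
  qed (auto simp: PiE_def Pi_def split: if_splits)
  finally show ?thesis .
qed

text \<open>Symmetry merges the two mixed terms into one, so the first-order term in
  \<open>t\<close> pairs the vector \<open>G x\<close> with the direction \<open>y\<close>. This is
  the first variation used to recognize a maximizer as an eigenvector.\<close>

lemma quad_form_add_scale:
  assumes sym: "\<And>i j. i \<in> {1..d} \<Longrightarrow> j \<in> {1..d} \<Longrightarrow> G i j = G j i"
  shows "quad_form d G (\<lambda>i. x i + t * y i) =
    quad_form d G x + 2 * t * (\<Sum>i = 1..d. (\<Sum>j = 1..d. G i j * x j) * y i) + t\<^sup>2 * quad_form d G y"
proof -
  have sw: "(\<Sum>i = 1..d. \<Sum>j = 1..d. G i j * x i * y j) = (\<Sum>i = 1..d. \<Sum>j = 1..d. G i j * x j * y i)"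
    by (subst sum.swap) (auto intro!: sum.cong simp: sym)
  have "quad_form d G (\<lambda>i. x i + t * y i) =
     (\<Sum>i = 1..d. \<Sum>j = 1..d. G i j * x i * x j + t * (G i j * x i * y j) + t * (G i j * x j * y i)
        + t\<^sup>2 * (G i j * y i * y j))"
    unfolding quad_form_def by (intro sum.cong refl) (simp add: algebra_simps power2_eq_square)
  also have "\<dots> = quad_form d G x + t * (\<Sum>i = 1..d. \<Sum>j = 1..d. G i j * x i * y j)
      + t * (\<Sum>i = 1..d. \<Sum>j = 1..d. G i j * x j * y i) + t\<^sup>2 * quad_form d G y"
    by (simp add: sum.distrib quad_form_def sum_distrib_left)
  also have "\<dots> = quad_form d G x + 2 * t * (\<Sum>i = 1..d. \<Sum>j = 1..d. G i j * x j * y i) + t\<^sup>2 * quad_form d G y"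
    unfolding sw by (simp add: algebra_simps)
  finally show ?thesis by (simp add: sum_distrib_right)
qed

lemma linear_coeff_zero_of_quadratic_nonneg:
  fixes b c :: real
  assumes "\<And>t. 0 \<le> 2 * t * b + t\<^sup>2 * c"
  shows "b = 0"
proof (rule ccontr)
  assume b: "b \<noteq> 0"
  \<comment> \<open>At \<open>t = - b / k\<close> the quadratic equals \<open>b^2 / k^2\<close>
    times \<open>c - 2 k\<close>; taking \<open>k > \<bar>c\<bar>\<close> makes this
    negative.\<close>
  define k where "k = 1 + \<bar>c\<bar>"
  have k: "k > 0" "c < 2 * k" by (auto simp: k_def)
  have "0 \<le> 2 * (- b / k) * b + (- b / k)\<^sup>2 * c" by (rule assms)
  also have "\<dots> = (b\<^sup>2 / k\<^sup>2) * (c - 2 * k)"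
    using k(1) by (simp add: field_simps power2_eq_square)
  also have "\<dots> < 0"
    using b k by (intro mult_pos_neg divide_pos_pos) auto
  finally show False by simp
qed

text \<open>By compactness the quadratic form attains its maximum over the unit sphere at some
  \<open>v\<close>. A first-order variation shows that \<open>v\<close> is an eigenvector whose
  eigenvalue is that maximum, so the maximum is at most \<open>lambda_max d G\<close>. Homogeneity
  carries the bound from the sphere to every vector.\<close>

lemma rayleigh_lambda_max:
  assumes sym: "\<And>i j. i \<in> {1..d} \<Longrightarrow> j \<in> {1..d} \<Longrightarrow> G i j = G j i" and d: "d \<ge> 1"
  shows "quad_form d G x \<le> lambda_max d G * (\<Sum>i = 1..d. (x i)\<^sup>2)"
proof -
  let ?n = "\<lambda>x. \<Sum>i = 1..d. (x i)\<^sup>2 :: real"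
  let ?K = "{x :: nat \<Rightarrow> real. (\<forall>i. i \<notin> {1..d} \<longrightarrow> x i = 0) \<and> ?n x = 1}"
  have e1: "(\<lambda>i. if i = 1 then 1 else 0) \<in> ?K"
    using d by (auto simp: if_distrib[of "\<lambda>x. x\<^sup>2"] cong: if_cong)
  have ne: "?K \<noteq> {}"
  proof
    assume 0: "?K = {}"
    from e1 show False unfolding 0 by simp
  qed
  have cont: "continuous_on ?K (quad_form d G)"
    by (rule continuous_on_subset[OF _ subset_UNIV], unfold quad_form_def)
       (intro continuous_intros continuous_on_product_coordinates)
  obtain v where v: "v \<in> ?K" and "\<forall>y \<in> ?K. quad_form d G y \<le> quad_form d G v"
    using continuous_attains_sup[OF compact_coordinate_sphere ne cont] by (elim bexE)
  hence v_max: "quad_form d G y \<le> quad_form d G v" if "y \<in> ?K" for y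
    using that by (elim bspec)
  define \<Lambda> where "\<Lambda> = quad_form d G v"
  have ray: "quad_form d G y \<le> \<Lambda> * ?n y" for y
  proof (cases "?n y = 0")
    case True
    hence "y i = 0" if "i \<in> {1..d}" for i
      using that by (subst (asm) sum_nonneg_eq_0_iff) auto
    hence "quad_form d G y = 0" unfolding quad_form_def by (intro sum.neutral) auto
    thus ?thesis using True by simp
  next
    case False
    hence pos: "?n y > 0" by (simp add: less_le sum_nonneg)
    define c where "c = 1 / sqrt (?n y)"
    have c2: "c\<^sup>2 = 1 / ?n y" using pos by (simp add: c_def power_divide)
    let ?y = "\<lambda>i. if i \<in> {1..d} then c * y i else 0"
    have "?n ?y = c\<^sup>2 * ?n y"
      by (simp add: sum_distrib_left power_mult_distrib)
    hence "?y \<in> ?K" using c2 pos by auto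
    from v_max[OF this] have "c\<^sup>2 * quad_form d G y \<le> \<Lambda>"
      unfolding \<Lambda>_def by (simp add: quad_form_def sum_distrib_left power2_eq_square mult_ac)
    thus ?thesis using pos by (simp add: c2 field_simps)
  qed
  have eig: "(\<Sum>j = 1..d. G i j * v j) = \<Lambda> * v i" if i: "i \<in> {1..d}" for i
  proof -
    let ?e = "\<lambda>k. if k = i then 1 else 0 :: real"
    \<comment> \<open>The function \<open>\<Lambda> |y|^2 - y^T G y\<close> is nonnegative and
      vanishes at \<open>v\<close>. Along \<open>v + t e_i\<close> it is a quadratic in
      \<open>t\<close> without constant term, so its linear coefficient, a multiple of the
      \<open>i\<close>-th entry of \<open>\<Lambda> v - G v\<close>, must be zero.\<close>
    have "0 \<le> 2 * t * (\<Lambda> * v i - (\<Sum>j = 1..d. G i j * v j)) + t\<^sup>2 * (\<Lambda> - quad_form d G ?e)" for t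
    proof -
      have s: "(\<Sum>k = 1..d. (\<Sum>j = 1..d. G k j * v j) * ?e k) = (\<Sum>j = 1..d. G i j * v j)"
        using i by (simp add: if_distrib cong: if_cong)
      have "?n (\<lambda>k. v k + t * ?e k) = ?n v + 2 * t * (\<Sum>k = 1..d. v k * ?e k) + t\<^sup>2 * (\<Sum>k = 1..d. ?e k)"
        unfolding sum_distrib_left sum.distrib[symmetric]
        by (intro sum.cong) (auto simp: power2_eq_square algebra_simps)
      also have "\<dots> = 1 + 2 * t * v i + t\<^sup>2"
        using i v by (simp add: if_distrib cong: if_cong)
      finally have "quad_form d G (\<lambda>k. v k + t * ?e k) \<le> \<Lambda> * (1 + 2 * t * v i + t\<^sup>2)"
        using ray by metis
      moreover have "quad_form d G (\<lambda>k. v k + t * ?e k) =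
          \<Lambda> + 2 * t * (\<Sum>j = 1..d. G i j * v j) + t\<^sup>2 * quad_form d G ?e"
        unfolding s[symmetric] \<Lambda>_def by (rule quad_form_add_scale) (rule sym)
      ultimately show ?thesis
        by (simp add: algebra_simps)
    qed
    from linear_coeff_zero_of_quadratic_nonneg[OF this] show ?thesis by simp
  qed
  let ?M = "mat d d (\<lambda>(i, j). G (Suc i) (Suc j))"
  let ?v = "vec d (\<lambda>i. v (Suc i))"
  have "eigenvector ?M ?v \<Lambda>"
    unfolding eigenvector_def
  proof (intro conjI)
    show "?v \<in> carrier_vec (dim_row ?M)" by simp
    show "?v \<noteq> 0\<^sub>v (dim_row ?M)"
    proof
      assume 0: "?v = 0\<^sub>v (dim_row ?M)"
      have "v i = 0" if "i \<in> {1..d}" for i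
        using arg_cong[OF 0, of "\<lambda>w. w $ (i - 1)"] that by auto
      hence "?n v = 0" by simp
      thus False using v by simp
    qed
    show "?M *\<^sub>v ?v = \<Lambda> \<cdot>\<^sub>v ?v"
    proof (rule eq_vecI)
      fix i assume "i < dim_vec (\<Lambda> \<cdot>\<^sub>v ?v)"
      hence i: "i < d" by simp
      have "(?M *\<^sub>v ?v) $ i = (\<Sum>j = 0..<d. G (Suc i) (Suc j) * v (Suc j))"
        using i by (simp add: scalar_prod_def)
      also have "\<dots> = (\<Sum>j = 1..d. G (Suc i) j * v j)"
        by (simp add: sum.atLeast1_atMost_eq atLeast0LessThan)
      also have "\<dots> = (\<Lambda> \<cdot>\<^sub>v ?v) $ i" using eig[of "Suc i"] i by simp
      finally show "(?M *\<^sub>v ?v) $ i = (\<Lambda> \<cdot>\<^sub>v ?v) $ i" .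
    qed simp
  qed
  hence ev: "\<Lambda> \<in> {x. eigenvalue ?M x}" by (auto simp: eigenvalue_def)
  have carr: "?M \<in> carrier_mat d d" by simp
  \<comment> \<open>\<open>lambda_max\<close> is a \<open>Max\<close>, which is informative only for
    a finite set; the eigenvalues are the roots of a nonzero polynomial.\<close>
  have "{x. eigenvalue ?M x} = {x. poly (char_poly ?M) x = 0}"
    using eigenvalue_root_char_poly[OF carr] by auto
  moreover have "char_poly ?M \<noteq> 0"
    using degree_monic_char_poly[OF carr] by auto
  ultimately have "finite {x. eigenvalue ?M x}"
    by (simp add: poly_roots_finite)
  hence "\<Lambda> \<le> lambda_max d G"
    unfolding lambda_max_def using ev by (rule Max_ge)
  hence "\<Lambda> * ?n x \<le> lambda_max d G * ?n x"
    by (intro mult_right_mono sum_nonneg) auto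
  thus ?thesis using ray[of x] by linarith
qed

text \<open>A matrix of the form \<open>A A^T\<close> has nonnegative diagonal, and its first
  diagonal entry is the Rayleigh quotient at the first unit vector. This supplies the condition
  \<open>0 \<le> \<Lambda>\<close> of \<open>gaussian_shrinkage_inequality\<close>.\<close>

lemma lambda_max_nonneg:
  assumes "\<And>i j. i \<in> {1..d} \<Longrightarrow> j \<in> {1..d} \<Longrightarrow> (\<Sum>k = 1..d. A i k * A j k) = G i j" and d: "d \<ge> 1"
  shows "0 \<le> lambda_max d G"
proof -
  let ?e = "\<lambda>k. if k = 1 then 1 else 0 :: real"
  have sym: "G i j = G j i" if "i \<in> {1..d}" "j \<in> {1..d}" for i j
    using that by (simp add: assms(1)[symmetric] mult.commute)
  have "0 \<le> (\<Sum>k = 1..d. A 1 k * A 1 k)" by (intro sum_nonneg) auto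
  also have "\<dots> = quad_form d G ?e"
    using d assms(1)[of 1 1] by (simp add: quad_form_def if_distrib[of "\<lambda>x. _ * x"] if_distrib[of "\<lambda>x. x * _"] cong: if_cong)
  also have "\<dots> \<le> lambda_max d G * (\<Sum>i = 1..d. (?e i)\<^sup>2)"
    by (rule rayleigh_lambda_max[OF sym d])
  also have "(\<Sum>i = 1..d. (?e i)\<^sup>2) = 1"
    using d by (simp add: if_distrib[of "\<lambda>x. x\<^sup>2"] cong: if_cong)
  finally show ?thesis by simp
qed

section \<open>Stochastic integrals of step functions\<close>

text \<open>For each threshold \<open>1 / Suc m\<close> the deviation probabilities are eventually
  constant and tend to zero, hence that constant is zero. Countably many thresholds give almost sure
  equality. It serves to identify a stochastic integral that is specified only as a limit in
  probability.\<close>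

lemma tendsto_in_prob_eventually_const:
  assumes M: "prob_space M" and meas [measurable]: "Z \<in> borel_measurable M" "Y \<in> borel_measurable M"
    and lim: "tendsto_in_prob M X Y" and ev: "\<forall>\<^sub>F k in sequentially. X k = Z"
  shows "AE \<omega> in M. Y \<omega> = Z \<omega>"
proof -
  interpret prob_space M by (rule M)
  have "AE \<omega> in M. \<bar>Z \<omega> - Y \<omega>\<bar> \<le> 1 / real (Suc m)" for m
  proof -
    let ?B = "\<lambda>V. {\<omega> \<in> space M. 1 / real (Suc m) < \<bar>V \<omega> - Y \<omega>\<bar>}"
    have "(\<lambda>k. measure M (?B (X k))) \<longlonglongrightarrow> 0"
      using lim unfolding tendsto_in_prob_def by simp
    moreover have "\<forall>\<^sub>F k in sequentially. measure M (?B (X k)) = measure M (?B Z)"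
      using ev by eventually_elim simp
    ultimately have "(\<lambda>k. measure M (?B Z)) \<longlonglongrightarrow> 0"
      by (simp add: tendsto_cong)
    hence "measure M (?B Z) = 0" by (simp add: LIMSEQ_const_iff)
    hence "emeasure M (?B Z) = 0" by (simp add: emeasure_eq_measure)
    hence "AE \<omega> in M. \<not> (1 / real (Suc m) < \<bar>Z \<omega> - Y \<omega>\<bar>)"
      by (subst AE_iff_measurable[of "?B Z"]) auto
    thus ?thesis by eventually_elim simp
  qed
  hence "AE \<omega> in M. \<forall>m. \<bar>Z \<omega> - Y \<omega>\<bar> \<le> 1 / real (Suc m)"
    by (simp add: AE_all_countable)
  thus ?thesis
  proof eventually_elim
    case (elim \<omega>)
    have "\<bar>Z \<omega> - Y \<omega>\<bar> \<le> 0"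
    proof (rule field_le_epsilon)
      fix e :: real assume "0 < e"
      then obtain m where "1 / real (Suc m) < e" using nat_approx_posE by blast
      with elim show "\<bar>Z \<omega> - Y \<omega>\<bar> \<le> 0 + e" by (meson add_increasing le_less_trans less_imp_le order_refl)
    qed
    thus ?case by simp
  qed
qed

lemma step_function_bounded_borel:
  assumes "finite K"
  shows "(\<lambda>x. \<Sum>k\<in>K. c k * indicator {a k<..b k :: real} x) \<in> bounded_borel_on T"
    and "\<bar>\<Sum>k\<in>K. c k * indicator {a k<..b k :: real} x\<bar> \<le> (\<Sum>k\<in>K. \<bar>c k :: real\<bar>)"
proof -
  show *: "\<bar>\<Sum>k\<in>K. c k * indicator {a k<..b k :: real} x\<bar> \<le> (\<Sum>k\<in>K. \<bar>c k\<bar>)" for x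
    by (rule order_trans[OF sum_abs]) (auto intro!: sum_mono simp: indicator_def)
  show "(\<lambda>x. \<Sum>k\<in>K. c k * indicator {a k<..b k :: real} x) \<in> bounded_borel_on T"
    unfolding bounded_borel_on_def using * by (auto intro!: exI[of _ "\<Sum>k\<in>K. \<bar>c k\<bar>"])
qed

lemma bounded_stoch_integral_step:
  assumes J: "bounded_stoch_integral M T X J" and "finite K"
    and "\<And>k. k \<in> K \<Longrightarrow> 0 \<le> a k \<and> a k \<le> b k \<and> b k \<le> T"
  shows "AE \<omega> in M. J (\<lambda>x. \<Sum>k\<in>K. c k * indicator {a k<..b k} x) \<omega> =
    (\<Sum>k\<in>K. c k * (X (b k) \<omega> - X (a k) \<omega>))"
proof -
  have lin: "AE \<omega> in M. J (\<lambda>x. u * f x + v * g x) \<omega> = u * J f \<omega> + v * J g \<omega>"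
    if "f \<in> bounded_borel_on T" "g \<in> bounded_borel_on T" for f g u v
    using J that unfolding bounded_stoch_integral_def by blast
  show ?thesis
    using assms(2,3)
  proof (induction K rule: finite_induct)
    case empty
    have 0: "(\<lambda>x. 0) \<in> bounded_borel_on T" by (auto simp: bounded_borel_on_def)
    \<comment> \<open>Almost sure linearity with both coefficients zero yields
      \<open>J (\<lambda>x. 0) = 0\<close> almost surely.\<close>
    show ?case using lin[OF 0 0, of 0 0] by simp
  next
    case (insert m K)
    let ?f = "\<lambda>x. \<Sum>k\<in>K. c k * indicator {a k<..b k} x"
    let ?i = "indicator {a m<..b m} :: real \<Rightarrow> real"
    have f: "?f \<in> bounded_borel_on T" using insert.hyps(1) by (rule step_function_bounded_borel)
    have i: "?i \<in> bounded_borel_on T"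
      by (auto simp: bounded_borel_on_def indicator_def intro!: exI[of _ 1])
    have "AE \<omega> in M. J (\<lambda>x. c m * ?i x + 1 * ?f x) \<omega> = c m * J ?i \<omega> + 1 * J ?f \<omega>"
      by (rule lin[OF i f])
    moreover have "AE \<omega> in M. J ?i \<omega> = X (b m) \<omega> - X (a m) \<omega>"
      using J insert.prems[of m] unfolding bounded_stoch_integral_def by blast
    moreover have "AE \<omega> in M. J ?f \<omega> = (\<Sum>k\<in>K. c k * (X (b k) \<omega> - X (a k) \<omega>))"
      using insert by auto
    ultimately show ?case
    proof eventually_elim
      case (elim \<omega>)
      show ?case
        unfolding sum.insert[OF insert.hyps] using elim by (simp only: mult_1)
    qed
  qed
qed

text \<open>Step functions are bounded, so the truncations in the definition of the stochastic integral
  are eventually constant and the choice made by \<open>SOME\<close> is almost surely unique.\<close>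

lemma stoch_integral_step:
  fixes c a b :: "nat \<Rightarrow> real" and K :: "nat set"
  defines "f \<equiv> \<lambda>x. \<Sum>k\<in>K. c k * indicator {a k<..b k} x"
  assumes M: "prob_space M" and K: "finite K"
    and ab: "\<And>k. k \<in> K \<Longrightarrow> 0 \<le> a k \<and> a k \<le> b k \<and> b k \<le> T"
    and ex: "\<exists>Y. has_stoch_integral M T X f Y"
  shows "AE \<omega> in M. stoch_integral M T X f \<omega> = (\<Sum>k\<in>K. c k * (X (b k) \<omega> - X (a k) \<omega>))"
proof -
  let ?Y = "stoch_integral M T X f"
  have "has_stoch_integral M T X f ?Y"
    unfolding stoch_integral_def using ex by (rule someI_ex)
  then obtain J where Y: "?Y \<in> borel_measurable M" and J: "bounded_stoch_integral M T X J"
    and lim: "tendsto_in_prob M (\<lambda>k. J (\<lambda>x. if \<bar>f x\<bar> \<le> real k then f x else 0)) ?Y"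
    unfolding has_stoch_integral_def by blast
  have f: "f \<in> bounded_borel_on T" and bound: "\<bar>f x\<bar> \<le> (\<Sum>k\<in>K. \<bar>c k\<bar>)" for x
    unfolding f_def by (rule step_function_bounded_borel[OF K])+
  have "\<forall>\<^sub>F k in sequentially. J (\<lambda>x. if \<bar>f x\<bar> \<le> real k then f x else 0) = J f"
    using eventually_ge_at_top[of "nat \<lceil>\<Sum>k\<in>K. \<bar>c k\<bar>\<rceil>"]
  proof eventually_elim
    case (elim k)
    hence "\<bar>f x\<bar> \<le> real k" for x using bound[of x] by linarith
    thus ?case by simp
  qed
  moreover have "J f \<in> borel_measurable M"
    using J f unfolding bounded_stoch_integral_def by blast
  ultimately have "AE \<omega> in M. ?Y \<omega> = J f \<omega>"
    using tendsto_in_prob_eventually_const[OF M _ Y lim] by blast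
  moreover have "AE \<omega> in M. J f \<omega> = (\<Sum>k\<in>K. c k * (X (b k) \<omega> - X (a k) \<omega>))"
    unfolding f_def by (rule bounded_stoch_integral_step[OF J K ab])
  ultimately show ?thesis by eventually_elim simp
qed

section \<open>Conditional laws\<close>

text \<open>Averaging the conditional probability of \<open>X\<close> lying in \<open>B\<close>
  gives its probability, so the law of \<open>X\<close> is the mixture of the kernels. Written with
  \<open>bind\<close>, integrals over this law become iterated integrals.\<close>

lemma regular_conditional_law_distr:
  assumes M: "prob_space M" and F: "subalgebra M F" and K: "regular_conditional_law M F N X K"
  shows "distr M N X = M \<bind> K"
proof -
  interpret prob_space M by (rule M)
  interpret finite_measure_subalgebra M F by unfold_locales (rule F)
  have X [measurable]: "X \<in> measurable M N"
    and KF: "K \<in> measurable F (prob_algebra N)"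
    and ce: "\<And>B. B \<in> sets N \<Longrightarrow>
      AE \<omega> in M. real_cond_exp M F (indicator (X -` B \<inter> space M)) \<omega> = measure (K \<omega>) B"
    using K unfolding regular_conditional_law_def by blast+
  have KM: "K \<in> measurable M (prob_algebra N)" using F KF by (rule measurable_from_subalg)
  hence KS [measurable]: "K \<in> measurable M (subprob_algebra N)" by (rule measurable_prob_algebraD)
  have Kp: "prob_space (K \<omega>)" if "\<omega> \<in> space M" for \<omega>
    using measurable_space[OF KM that] by (simp add: space_prob_algebra)
  show ?thesis
  proof (rule measure_eqI)
    show "sets (distr M N X) = sets (M \<bind> K)"
      by (simp add: sets_bind_measurable[OF KS not_empty])
    fix B assume "B \<in> sets (distr M N X)"
    hence B [measurable]: "B \<in> sets N" by simp
    let ?A = "X -` B \<inter> space M"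
    have A: "?A \<in> sets M" by measurable
    have int: "integrable M (indicator ?A :: _ \<Rightarrow> real)" using A by (simp add: integrable_indicator_iff emeasure_eq_measure)
    have Km: "(\<lambda>\<omega>. measure (K \<omega>) B) \<in> borel_measurable M" by measurable
    have "measure M ?A = (\<integral>\<omega>. indicator ?A \<omega> \<partial>M)" using A by simp
    also have "\<dots> = (\<integral>\<omega>. real_cond_exp M F (indicator ?A) \<omega> \<partial>M)"
      by (rule real_cond_exp_int(2)[OF int, symmetric])
    also have "\<dots> = (\<integral>\<omega>. measure (K \<omega>) B \<partial>M)"
      by (rule integral_cong_AE[OF _ Km ce[OF B]]) simp
    finally have eq: "measure M ?A = (\<integral>\<omega>. measure (K \<omega>) B \<partial>M)" .
    have "emeasure (M \<bind> K) B = (\<integral>\<^sup>+\<omega>. emeasure (K \<omega>) B \<partial>M)"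
      by (rule emeasure_bind[OF not_empty KS B])
    also have "\<dots> = (\<integral>\<^sup>+\<omega>. ennreal (measure (K \<omega>) B) \<partial>M)"
      by (intro nn_integral_cong) (auto dest!: Kp simp: finite_measure.emeasure_eq_measure prob_space_def)
    also have "\<dots> = ennreal (\<integral>\<omega>. measure (K \<omega>) B \<partial>M)"
    proof (rule nn_integral_eq_integral)
      show "integrable M (\<lambda>\<omega>. measure (K \<omega>) B)"
        by (rule integrable_const_bound[where B = 1]) (use Kp Km in \<open>auto simp: prob_space.prob_le_1\<close>)
    qed simp
    also have "\<dots> = emeasure (distr M N X) B"
      by (simp add: emeasure_distr eq[symmetric] emeasure_eq_measure)
    finally show "emeasure (distr M N X) B = emeasure (M \<bind> K) B" ..
  qed
qed

text \<open>The iterated-integral formula for \<open>bind\<close> is used for nonnegative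
  integrands, so \<open>h\<close> is first raised by a constant above its lower bound and lowered
  again at the end. Thus only a one-sided bound on \<open>h\<close> is required, besides
  integrability.\<close>

lemma regular_conditional_law_integral_nonneg:
  fixes h :: "'b \<Rightarrow> real"
  assumes M: "prob_space M" and F: "subalgebra M F" and K: "regular_conditional_law M F N X K"
    and h [measurable]: "h \<in> borel_measurable N" and lb: "\<And>x. x \<in> space N \<Longrightarrow> - C \<le> h x"
    and int: "integrable M (\<lambda>\<omega>. h (X \<omega>))"
    and pos: "AE \<omega> in M. integrable (K \<omega>) h \<and> 0 \<le> (\<integral>x. h x \<partial>K \<omega>)"
  shows "0 \<le> (\<integral>\<omega>. h (X \<omega>) \<partial>M)"
proof -
  interpret prob_space M by (rule M)
  have X [measurable]: "X \<in> measurable M N"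
    and KF: "K \<in> measurable F (prob_algebra N)"
    using K unfolding regular_conditional_law_def by blast+
  have KM: "K \<in> measurable M (prob_algebra N)" using F KF by (rule measurable_from_subalg)
  hence KS: "K \<in> measurable M (subprob_algebra N)" by (rule measurable_prob_algebraD)
  have Kp: "prob_space (K \<omega>)" "space (K \<omega>) = space N" if "\<omega> \<in> space M" for \<omega>
    using measurable_space[OF KM that] by (auto simp: space_prob_algebra intro!: sets_eq_imp_space_eq)
  \<comment> \<open>The maximum with zero keeps the shift itself nonnegative, so that
    \<open>ennreal c\<close> does not truncate it.\<close>
  define c where "c = max C 0"
  have c: "0 \<le> c" "\<And>x. x \<in> space N \<Longrightarrow> 0 \<le> h x + c"
    using lb by (force simp: c_def)+
  have XN: "X \<omega> \<in> space N" if "\<omega> \<in> space M" for \<omega>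
    using measurable_space[OF X that] .
  have "ennreal c = (\<integral>\<^sup>+\<omega>. ennreal c \<partial>M)" by (simp add: emeasure_space_1)
  also have "\<dots> \<le> (\<integral>\<^sup>+\<omega>. \<integral>\<^sup>+x. ennreal (h x + c) \<partial>K \<omega> \<partial>M)"
  proof (rule nn_integral_mono_AE)
    show "AE \<omega> in M. ennreal c \<le> (\<integral>\<^sup>+x. ennreal (h x + c) \<partial>K \<omega>)"
      using pos AE_space
    proof eventually_elim
      case (elim \<omega>)
      interpret K: prob_space "K \<omega>" using elim by (intro Kp)
      have "(\<integral>\<^sup>+x. ennreal (h x + c) \<partial>K \<omega>) = ennreal (\<integral>x. h x + c \<partial>K \<omega>)"
        using elim Kp(2) c by (intro nn_integral_eq_integral) auto
      also have "(\<integral>x. h x + c \<partial>K \<omega>) = (\<integral>x. h x \<partial>K \<omega>) + c"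
        using elim by (simp add: K.prob_space)
      finally show ?case using elim by (simp add: ennreal_leI)
    qed
  qed
  also have "\<dots> = (\<integral>\<^sup>+x. ennreal (h x + c) \<partial>(M \<bind> K))"
    by (rule nn_integral_bind[symmetric, OF _ KS]) measurable
  also have "\<dots> = (\<integral>\<^sup>+\<omega>. ennreal (h (X \<omega>) + c) \<partial>M)"
    unfolding regular_conditional_law_distr[OF M F K, symmetric] by (subst nn_integral_distr) auto
  also have "\<dots> = ennreal (\<integral>\<omega>. h (X \<omega>) + c \<partial>M)"
    using int c(2) XN by (intro nn_integral_eq_integral) auto
  also have "(\<integral>\<omega>. h (X \<omega>) + c \<partial>M) = (\<integral>\<omega>. h (X \<omega>) \<partial>M) + c"
    using int by (simp add: prob_space)
  finally have "ennreal c \<le> ennreal ((\<integral>\<omega>. h (X \<omega>) \<partial>M) + c)" .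
  \<comment> \<open>\<open>ennreal\<close> sends negative numbers to zero, so the inequality can be
    read back in the reals only after the right-hand side is known to be nonnegative.\<close>
  moreover have "0 \<le> (\<integral>\<omega>. h (X \<omega>) + c \<partial>M)"
    using c(2) XN by (intro integral_nonneg_AE) auto
  hence "0 \<le> (\<integral>\<omega>. h (X \<omega>) \<partial>M) + c" using int by (simp add: prob_space)
  ultimately show ?thesis by (simp add: ennreal_le_iff)
qed

section \<open>The grid coefficients of a periodic signal\<close>

lemma sum_periodic:
  fixes F :: "nat \<Rightarrow> real"
  assumes "\<And>l. 1 \<le> l \<Longrightarrow> F (l + p) = F l"
  shows "(\<Sum>l = 1..n * p. F l) = real n * (\<Sum>l = 1..p. F l)"
proof (induction n)
  case (Suc n)
  have per: "F (l + n * p) = F l" if "1 \<le> l" for l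
  proof (induction n)
    case (Suc n)
    thus ?case using assms[of "l + n * p"] that by (simp add: add_ac)
  qed simp
  have "(\<Sum>l = 1..Suc n * p. F l) = (\<Sum>l = 1..n * p. F l) + (\<Sum>l = n * p + 1..n * p + p. F l)"
    using sum.ub_add_nat[of 1 "n * p" F p] by (simp add: add.commute)
  also have "(\<Sum>l = n * p + 1..n * p + p. F l) = (\<Sum>l = 1..p. F (l + n * p))"
    using sum.shift_bounds_cl_nat_ivl[of F 1 "n * p" p] by (simp add: add.commute)
  also have "\<dots> = (\<Sum>l = 1..p. F l)" by (intro sum.cong) (auto simp: per)
  finally show ?case using Suc by (simp add: algebra_simps)
qed simp

lemma one_periodic_bounded:
  assumes per: "one_periodic S" and bound: "\<And>t. t \<in> {0..1} \<Longrightarrow> \<bar>S t\<bar> \<le> B"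
  shows "\<bar>S t\<bar> \<le> B"
proof -
  have nat: "S (t + real k) = S t" for t k
  proof (induction k)
    case (Suc k)
    have "S ((t + real k) + 1) = S (t + real k)" using per unfolding one_periodic_def by blast
    thus ?case using Suc by (simp add: add_ac)
  qed simp
  have int: "S (t + real_of_int i) = S t" for i
  proof (cases "0 \<le> i")
    case True thus ?thesis using nat[of t "nat i"] by simp
  next
    case False thus ?thesis using nat[of "t + real_of_int i" "nat (- i)"] by simp
  qed
  have "S t = S (frac t)" using int[of "- \<lfloor>t\<rfloor>"] by (simp add: frac_def)
  moreover have "frac t \<in> {0..1}" by (simp add: frac_ge_0 less_imp_le frac_lt_1)
  ultimately show ?thesis using bound by simp
qed

section \<open>Integrals of bounded periodic functions over grid cells\<close>

lemma set_integrable_bounded_Icc: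
  fixes f :: "real \<Rightarrow> real"
  assumes [measurable]: "f \<in> borel_measurable borel" and "\<And>t. \<bar>f t\<bar> \<le> B"
    and "A \<in> sets borel" "A \<subseteq> {a..b}"
  shows "set_integrable lborel A f"
proof -
  have "set_integrable lborel {a..b} f"
    unfolding set_integrable_def
  proof (rule integrableI_bounded_set_indicator[where B = B])
    show "emeasure lborel {a..b} < \<infinity>" by (simp add: emeasure_lborel_Icc_eq)
  qed (use assms in auto)
  thus ?thesis by (rule set_integrable_subset) (use assms in auto)
qed

lemma set_integral_Icc_diff:
  fixes f :: "real \<Rightarrow> real"
  assumes "f \<in> borel_measurable borel" "\<And>t. \<bar>f t\<bar> \<le> B" and "0 \<le> s" "s \<le> t"
  shows "(LINT x:{0..t}|lborel. f x) - (LINT x:{0..s}|lborel. f x) = (LINT x:{s<..t}|lborel. f x)"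
proof -
  have "{0..t} = {0..s} \<union> {s<..t}" using assms(3,4) by auto
  moreover have "(LINT x:{0..s} \<union> {s<..t}|lborel. f x) =
      (LINT x:{0..s}|lborel. f x) + (LINT x:{s<..t}|lborel. f x)"
    using assms by (intro set_integral_Un) (auto intro!: set_integrable_bounded_Icc[where a = 0 and b = t])
  ultimately show ?thesis by simp
qed

lemma set_integral_Ioc_shift:
  fixes f :: "real \<Rightarrow> real"
  assumes "one_periodic f"
  shows "(LINT x:{s + 1<..t + 1}|lborel. f x) = (LINT x:{s<..t}|lborel. f x)"
proof -
  have "(LINT x:{s + 1<..t + 1}|lborel. f x) =
      (\<integral>x. indicator {s + 1<..t + 1} (1 + 1 * x) *\<^sub>R f (1 + 1 * x) \<partial>lborel)"
    unfolding set_lebesgue_integral_def by (subst lborel_integral_real_affine[where c = 1 and t = 1]) auto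
  also have "\<dots> = (LINT x:{s<..t}|lborel. f x)"
    unfolding set_lebesgue_integral_def
    using assms by (intro Bochner_Integration.integral_cong) (auto simp: one_periodic_def indicator_def add.commute)
  finally show ?thesis .
qed

lemma set_integral_const_Ioc:
  assumes "s \<le> t"
  shows "(LINT x:{s<..t}|lborel. (c :: real)) = c * (t - s)"
    and "set_integrable lborel {s<..t} (\<lambda>_. c :: real)"
  using assms by (auto simp: set_lebesgue_integral_def set_integrable_def integrable_indicator_iff intro!: integrable_mult_left)

definition cell_integral :: "nat \<Rightarrow> (real \<Rightarrow> real) \<Rightarrow> nat \<Rightarrow> real" where
  "cell_integral p S l = (LINT x:{(real l - 1) / real p <.. real l / real p}|lborel. S x)"

text \<open>The coefficient \<open>(S, \<psi>\<^sub>j)\<close>, evaluated cell by cell.\<close>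

definition theta_bar :: "nat \<Rightarrow> (nat \<Rightarrow> real \<Rightarrow> real) \<Rightarrow> (real \<Rightarrow> real) \<Rightarrow> nat \<Rightarrow> real" where
  "theta_bar p \<phi> S j = (\<Sum>l = 1..p. \<phi> j (real l / real p) * cell_integral p S l)"

lemma grid_basisD:
  assumes "grid_basis p \<phi> \<phi>s"
  shows "j \<in> {1..p} \<Longrightarrow> one_periodic (\<phi> j)"
    and "i \<in> {1..p} \<Longrightarrow> j \<in> {1..p} \<Longrightarrow>
      (\<Sum>l = 1..p. \<phi> i (real l / real p) * \<phi> j (real l / real p)) = (if i = j then real p else 0)"
    and "j \<in> {1..p} \<Longrightarrow> l \<in> {1..p} \<Longrightarrow> \<bar>\<phi> j (real l / real p)\<bar> \<le> \<phi>s"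
proof -
  show "i \<in> {1..p} \<Longrightarrow> j \<in> {1..p} \<Longrightarrow>
      (\<Sum>l = 1..p. \<phi> i (real l / real p) * \<phi> j (real l / real p)) = (if i = j then real p else 0)"
  proof -
    assume ij: "i \<in> {1..p}" "j \<in> {1..p}"
    hence "(\<Sum>l = 1..p. \<phi> i (real l / real p) * \<phi> j (real l / real p)) / real p = (if i = j then 1 else 0)"
      using assms unfolding grid_basis_def by blast
    thus ?thesis using ij by (auto simp: field_simps split: if_splits)
  qed
  show "j \<in> {1..p} \<Longrightarrow> one_periodic (\<phi> j)"
    using assms unfolding grid_basis_def by blast
  show "j \<in> {1..p} \<Longrightarrow> l \<in> {1..p} \<Longrightarrow> \<bar>\<phi> j (real l / real p)\<bar> \<le> \<phi>s"
    using assms unfolding grid_basis_def by auto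
qed

lemma grid_periodic:
  assumes "one_periodic f" "p \<ge> 1"
  shows "f (real (l + p) / real p) = f (real l / real p)"
proof -
  have "real (l + p) / real p = real l / real p + 1" using assms(2) by (simp add: field_simps)
  thus ?thesis using assms(1) by (simp add: one_periodic_def)
qed

lemma cell_integral_periodic:
  assumes "one_periodic S" "p \<ge> 1"
  shows "cell_integral p S (l + p) = cell_integral p S l"
proof -
  have "real (l + p) / real p = real l / real p + 1"
    "(real (l + p) - 1) / real p = (real l - 1) / real p + 1"
    using assms(2) by (simp_all add: field_simps)
  thus ?thesis unfolding cell_integral_def using set_integral_Ioc_shift[OF assms(1)] by simp
qed

text \<open>The Lipschitz condition bounds \<open>S\<close> on one period and periodicity does the
  rest. The integrability of \<open>S\<close> and of its square on grid cells rests on this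
  bound.\<close>

lemma signal_class_bounded:
  assumes S: "S \<in> signal_class L r"
  obtains B where "\<And>t. \<bar>S t\<bar> \<le> B"
proof -
  have lip: "L-lipschitz_on {0..1} S" and per: "one_periodic S"
    using S by (auto simp: signal_class_def)
  have L: "0 \<le> L" using lip by (rule lipschitz_on_nonneg)
  have "\<bar>S t\<bar> \<le> \<bar>S 0\<bar> + L" if "t \<in> {0..1}" for t
  proof -
    have "\<bar>S t - S 0\<bar> \<le> L * \<bar>t - 0\<bar>"
      using lipschitz_onD[OF lip that, of 0] by (simp add: dist_real_def)
    also have "\<dots> \<le> L * 1" using that L by (intro mult_left_mono) auto
    finally show ?thesis by linarith
  qed
  thus ?thesis using that one_periodic_bounded[OF per] by blast
qed

text \<open>This is the error of a right-endpoint Riemann sum. On a cell of length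
  \<open>1 / p\<close> the signal differs from its right endpoint value by at most
  \<open>L / p\<close>, so a cell contributes at most \<open>L / p^2\<close>; there are
  \<open>p\<close> cells, each weighted by at most \<open>\<phi>s\<close>.\<close>

lemma theta_bar_approx:
  assumes S: "S \<in> signal_class L r" and basis: "grid_basis p \<phi> \<phi>s" and j: "j \<in> {1..p}"
  shows "\<bar>theta_bar p \<phi> S j - theta p \<phi> S j\<bar> \<le> \<phi>s * L / real p"
proof -
  have p: "real p > 0" using j by simp
  have lip: "L-lipschitz_on {0..1} S" and Sm: "S \<in> borel_measurable borel"
    using S by (auto simp: signal_class_def L2_on_def)
  have L: "0 \<le> L" using lip by (rule lipschitz_on_nonneg)
  obtain B where B: "\<And>t. \<bar>S t\<bar> \<le> B" using signal_class_bounded[OF S] by blast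
  have cell: "\<bar>cell_integral p S l - S (real l / real p) / real p\<bar> \<le> L / (real p)\<^sup>2" if l: "l \<in> {1..p}" for l
  proof -
    let ?s = "(real l - 1) / real p" and ?t = "real l / real p"
    have st: "0 \<le> ?s" "?s \<le> ?t" "?t \<le> 1" "?t - ?s = 1 / real p"
      using l p by (auto simp: field_simps)
    have int: "set_integrable lborel {?s<..?t} S"
      using Sm B by (rule set_integrable_bounded_Icc[where a = 0 and b = 1]) (use st in auto)
    have *: "(LINT x:{?s<..?t}|lborel. S x - S ?t) = cell_integral p S l - S ?t / real p"
      unfolding cell_integral_def using st int
      by (subst set_integral_diff) (auto simp: set_integral_const_Ioc)
    have "\<bar>LINT x:{?s<..?t}|lborel. S x - S ?t\<bar> \<le> (LINT x:{?s<..?t}|lborel. \<bar>S x - S ?t\<bar>)"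
      using set_integral_norm_bound[of lborel "{?s<..?t}" "\<lambda>x. S x - S ?t"] st int
      by (simp add: set_integral_diff set_integral_const_Ioc)
    also have "\<dots> \<le> (LINT x:{?s<..?t}|lborel. L / real p)"
    proof (rule set_integral_mono)
      show "set_integrable lborel {?s<..?t} (\<lambda>x. \<bar>S x - S ?t\<bar>)"
        using st int by (intro set_integrable_abs set_integral_diff set_integral_const_Ioc)
      fix x assume x: "x \<in> {?s<..?t}"
      have "\<bar>S x - S ?t\<bar> \<le> L * \<bar>x - ?t\<bar>"
        using lipschitz_onD[OF lip, of x ?t] x st by (auto simp: dist_real_def)
      also have "\<dots> \<le> L * (1 / real p)" using x st L by (intro mult_left_mono) auto
      finally show "\<bar>S x - S ?t\<bar> \<le> L / real p" by simp
    qed (use st in \<open>simp add: set_integral_const_Ioc\<close>)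
    also have "\<dots> = L / (real p)\<^sup>2"
      using st by (simp add: set_integral_const_Ioc power2_eq_square)
    finally show ?thesis unfolding * .
  qed
  have "theta_bar p \<phi> S j - theta p \<phi> S j =
      (\<Sum>l = 1..p. \<phi> j (real l / real p) * (cell_integral p S l - S (real l / real p) / real p))"
    by (simp add: theta_bar_def theta_def sum_divide_distrib sum_subtractf[symmetric] algebra_simps)
  also have "\<bar>\<dots>\<bar> \<le> (\<Sum>l = 1..p. \<phi>s * (L / (real p)\<^sup>2))"
  proof (intro order_trans[OF sum_abs] sum_mono)
    fix l assume l: "l \<in> {1..p}"
    have \<phi>: "\<bar>\<phi> j (real l / real p)\<bar> \<le> \<phi>s" by (rule grid_basisD(3)[OF basis j l])
    show "\<bar>\<phi> j (real l / real p) * (cell_integral p S l - S (real l / real p) / real p)\<bar> \<le> \<phi>s * (L / (real p)\<^sup>2)"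
      unfolding abs_mult using \<phi> cell[OF l] by (intro mult_mono order_trans[OF abs_ge_zero \<phi>]) auto
  qed
  also have "\<dots> = \<phi>s * L / real p" using p by (simp add: power2_eq_square)
  finally show ?thesis .
qed

text \<open>The numbers \<open>w l\<close> are the cell values of the step function with
  coefficients \<open>b\<close>. By orthonormality on the grid its squared norm is \<open>T\<close>,
  and its inner product with \<open>S\<close> is \<open>T\<close> as well. The inequality
  \<open>2 x y \<le> x^2 + y^2\<close> on each cell then bounds \<open>T\<close> by half of the
  squared norm of \<open>S\<close> plus half of \<open>T\<close>.\<close>

lemma theta_bar_bessel:
  assumes S: "S \<in> signal_class L r" and basis: "grid_basis p \<phi> \<phi>s" and dp: "d \<le> p" and p: "p \<ge> 1"
  shows "dnorm d (theta_bar p \<phi> S) \<le> r"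
proof -
  have Sm [measurable]: "S \<in> borel_measurable borel" and nr: "L2_norm01 S \<le> r"
    using S by (auto simp: signal_class_def L2_on_def)
  obtain B where B: "\<And>t. \<bar>S t\<bar> \<le> B" using signal_class_bounded[OF S] by blast
  have B2: "\<bar>(S t)\<^sup>2\<bar> \<le> B\<^sup>2" for t
    using power_mono[OF B[of t] abs_ge_zero, of 2] by simp
  define b where "b = theta_bar p \<phi> S"
  define T where "T = (\<Sum>j = 1..d. (b j)\<^sup>2)"
  define w where "w = (\<lambda>l. \<Sum>j = 1..d. b j * \<phi> j (real l / real p))"
  have w2: "(\<Sum>l = 1..p. (w l)\<^sup>2) = real p * T"
  proof -
    have "(\<Sum>l = 1..p. (w l)\<^sup>2) =
        (\<Sum>l = 1..p. \<Sum>i = 1..d. \<Sum>j = 1..d. b i * b j * (\<phi> i (real l / real p) * \<phi> j (real l / real p)))"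
      by (simp add: w_def power2_eq_square sum_product mult_ac)
    also have "\<dots> = (\<Sum>i = 1..d. \<Sum>l = 1..p. \<Sum>j = 1..d. b i * b j * (\<phi> i (real l / real p) * \<phi> j (real l / real p)))"
      by (rule sum.swap)
    also have "\<dots> = (\<Sum>i = 1..d. \<Sum>j = 1..d. \<Sum>l = 1..p. b i * b j * (\<phi> i (real l / real p) * \<phi> j (real l / real p)))"
      by (rule sum.cong[OF refl], rule sum.swap)
    also have "\<dots> = (\<Sum>i = 1..d. \<Sum>j = 1..d. b i * b j * (if i = j then real p else 0))"
      unfolding sum_distrib_left[symmetric]
      using dp by (intro sum.cong refl arg_cong2[where f = "(*)"] grid_basisD(2)[OF basis]) auto
    also have "\<dots> = real p * T"
      by (simp add: if_distrib[of "\<lambda>x. _ * x"] T_def sum_distrib_left power2_eq_square mult_ac cong: if_cong)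
    finally show ?thesis .
  qed
  have cellb: "w l * cell_integral p S l \<le> (cell_integral p (\<lambda>x. (S x)\<^sup>2) l + (w l)\<^sup>2 / real p) / 2"
    if l: "l \<in> {1..p}" for l
  proof -
    let ?s = "(real l - 1) / real p" and ?t = "real l / real p"
    have st: "0 \<le> ?s" "?s \<le> ?t" "?t \<le> 1" "?t - ?s = 1 / real p"
      using l by (auto simp: field_simps)
    have int: "set_integrable lborel {?s<..?t} S"
      using Sm B by (rule set_integrable_bounded_Icc[where a = 0 and b = 1]) (use st in auto)
    have int2: "set_integrable lborel {?s<..?t} (\<lambda>x. (S x)\<^sup>2)"
      by (rule set_integrable_bounded_Icc[where a = 0 and b = 1, OF _ B2]) (use st in auto)
    have intc: "set_integrable lborel {?s<..?t} (\<lambda>x. (w l)\<^sup>2)"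
      using st by (intro set_integral_const_Ioc)
    have "w l * cell_integral p S l = (LINT x:{?s<..?t}|lborel. w l * S x)"
      by (simp add: cell_integral_def)
    also have "\<dots> \<le> (LINT x:{?s<..?t}|lborel. ((S x)\<^sup>2 + (w l)\<^sup>2) / 2)"
    proof (rule set_integral_mono)
      show "w l * S x \<le> ((S x)\<^sup>2 + (w l)\<^sup>2) / 2" for x
        using sum_squares_bound[of "w l" "S x"] by simp
    qed (use int int2 intc in \<open>auto intro!: set_integral_add\<close>)
    also have "\<dots> = (cell_integral p (\<lambda>x. (S x)\<^sup>2) l + (w l)\<^sup>2 / real p) / 2"
      unfolding cell_integral_def using st int2 intc
      by (simp add: set_integral_add set_integral_const_Ioc)
    finally show ?thesis .
  qed
  have "T = (\<Sum>j = 1..d. \<Sum>l = 1..p. b j * \<phi> j (real l / real p) * cell_integral p S l)"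
    by (simp add: T_def power2_eq_square sum_distrib_left b_def theta_bar_def mult.assoc)
  also have "\<dots> = (\<Sum>l = 1..p. w l * cell_integral p S l)"
    by (subst sum.swap) (simp add: w_def sum_distrib_right)
  also have "\<dots> \<le> (\<Sum>l = 1..p. (cell_integral p (\<lambda>x. (S x)\<^sup>2) l + (w l)\<^sup>2 / real p) / 2)"
    by (intro sum_mono cellb)
  also have "\<dots> = ((\<Sum>l = 1..p. cell_integral p (\<lambda>x. (S x)\<^sup>2) l) + T) / 2"
    using w2 p by (simp add: sum_divide_distrib[symmetric] sum.distrib)
  finally have T: "T \<le> (\<Sum>l = 1..p. cell_integral p (\<lambda>x. (S x)\<^sup>2) l)" by simp
  \<comment> \<open>The primitive of the squared signal: the cells tile \<open>(0, 1]\<close>, so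
    the cell integrals telescope to the integral over a full period.\<close>
  let ?E = "\<lambda>t. LINT x:{0..t}|lborel. (S x)\<^sup>2"
  have "(\<Sum>l = 1..p. cell_integral p (\<lambda>x. (S x)\<^sup>2) l) =
      (\<Sum>l = 1..p. ?E (real l / real p) - ?E (real (l - 1) / real p))"
  proof (intro sum.cong refl)
    fix l assume l: "l \<in> {1..p}"
    show "cell_integral p (\<lambda>x. (S x)\<^sup>2) l = ?E (real l / real p) - ?E (real (l - 1) / real p)"
      unfolding cell_integral_def using l
      by (subst set_integral_Icc_diff[OF _ B2]) (auto simp: divide_right_mono of_nat_diff)
  qed
  also have "\<dots> = ?E 1 - ?E 0"
    using sum_telescope''[of 0 p "\<lambda>l. ?E (real l / real p)"] p by (simp add: atLeastSucAtMost_greaterThanAtMost)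
  also have "\<dots> \<le> ?E 1"
    by (simp add: set_lebesgue_integral_def)
  finally have "T \<le> ?E 1" using T by simp
  hence "sqrt T \<le> L2_norm01 S"
    unfolding L2_norm01_def by (rule real_sqrt_le_mono)
  thus ?thesis using nr by (simp add: dnorm_def T_def b_def)
qed

section \<open>The estimator on the grid\<close>

text \<open>At every point at most one summand is nonzero, so no cross terms arise.\<close>

lemma sum_indicator_square:
  fixes c :: "'b \<Rightarrow> real"
  assumes "finite K" "disjoint_family_on A K"
  shows "(\<Sum>k\<in>K. c k * indicator (A k) t)\<^sup>2 = (\<Sum>k\<in>K. (c k)\<^sup>2 * indicator (A k) t)"
proof (cases "\<exists>m\<in>K. t \<in> A m")
  case True
  then obtain m where m: "m \<in> K" "t \<in> A m" by blast
  have "indicator (A k) t = (if k = m then 1 else 0 :: real)" if "k \<in> K" for k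
    using that m assms(2) by (auto simp: disjoint_family_on_def indicator_def)
  hence "(\<Sum>k\<in>K. f k * indicator (A k) t) = f m" for f :: "'b \<Rightarrow> real"
    using assms(1) m by (simp add: if_distrib[of "\<lambda>x. _ * x"] cong: if_cong)
  thus ?thesis by simp
next
  case False
  hence "(\<Sum>k\<in>K. f k * indicator (A k) t) = 0" for f :: "'b \<Rightarrow> real"
    by (intro sum.neutral) auto
  thus ?thesis by simp
qed

lemma grid_cell_bounds:
  assumes "p \<ge> 1" "k \<in> {1..n * p}"
  shows "0 \<le> (real k - 1) / real p" "(real k - 1) / real p \<le> real k / real p" "real k / real p \<le> real n"
proof -
  have "real k \<le> real n * real p" using assms(2) by (metis atLeastAtMost_iff of_nat_le_iff of_nat_mult)
  thus "real k / real p \<le> real n" using assms(1) by (simp add: divide_le_eq)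
qed (use assms in \<open>auto intro: divide_right_mono\<close>)

lemma step_basis_square:
  assumes "p \<ge> 1"
  shows "(step_basis n p \<phi> j t)\<^sup>2 =
    (\<Sum>k = 1..n * p. (\<phi> j (real k / real p))\<^sup>2 * indicator {(real k - 1) / real p <.. real k / real p} t)"
  unfolding step_basis_def
proof (rule sum_indicator_square)
  show "disjoint_family_on (\<lambda>k. {(real k - 1) / real p <.. real k / real p}) {1..n * p}"
    unfolding disjoint_family_on_def
  proof (intro ballI impI equals0I)
    fix k m t
    assume "k \<noteq> m" and "t \<in> {(real k - 1) / real p <.. real k / real p} \<inter> {(real m - 1) / real p <.. real m / real p}"
    hence "real k - 1 < t * real p" "t * real p \<le> real k" "real m - 1 < t * real p" "t * real p \<le> real m"
      using assms by (simp_all add: pos_divide_less_eq pos_le_divide_eq)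
    hence "real k < real (m + 1)" "real m < real (k + 1)" by linarith+
    thus False using \<open>k \<noteq> m\<close> unfolding of_nat_less_iff by linarith
  qed
qed simp

text \<open>The squared norm is \<open>n\<close> because the interval consists of \<open>n\<close>
  periods and each contributes one by orthonormality on the grid. Dividing the integral by
  \<open>sqrt n\<close> therefore leaves a second moment of at most
  \<open>\<kappa> Q\<close>.\<close>

lemma step_basis_L2:
  assumes basis: "grid_basis p \<phi> \<phi>s" and j: "j \<in> {1..p}"
  shows "L2_on 0 (real n) (step_basis n p \<phi> j)"
    and "(LINT t:{0..real n}|lborel. (step_basis n p \<phi> j t)\<^sup>2) = real n"
proof -
  have p: "p \<ge> 1" using j by simp
  let ?C = "\<lambda>k. {(real k - 1) / real p <.. real k / real p}"
  have sub: "?C k \<subseteq> {0..real n}" if "k \<in> {1..n * p}" for k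
    using grid_cell_bounds[OF p that] by auto
  have eq: "indicator {0..real n} t *\<^sub>R (step_basis n p \<phi> j t)\<^sup>2 =
      (\<Sum>k = 1..n * p. (\<phi> j (real k / real p))\<^sup>2 * indicator (?C k) t)" for t
    unfolding step_basis_square[OF p] real_scaleR_def sum_distrib_left
  proof (intro sum.cong refl)
    fix k assume "k \<in> {1..n * p}"
    hence "t \<in> ?C k \<Longrightarrow> t \<in> {0..real n}" using sub by blast
    thus "indicator {0..real n} t * ((\<phi> j (real k / real p))\<^sup>2 * indicator (?C k) t) =
        (\<phi> j (real k / real p))\<^sup>2 * indicator (?C k) t"
      by (cases "t \<in> ?C k") (simp_all only: indicator_simps mult_1 mult_zero_right simp_thms)
  qed
  have int: "integrable lborel (\<lambda>t. (\<phi> j (real k / real p))\<^sup>2 * indicator (?C k) t)" if "k \<in> {1..n * p}" for k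
    using grid_cell_bounds[OF p that] by (simp add: integrable_indicator_iff)
  have meas: "step_basis n p \<phi> j \<in> borel_measurable borel"
    unfolding step_basis_def[abs_def] by measurable
  show "L2_on 0 (real n) (step_basis n p \<phi> j)"
    unfolding L2_on_def set_integrable_def eq
    by (intro conjI Bochner_Integration.integrable_sum int meas)
  have cell: "(\<integral>t. (\<phi> j (real k / real p))\<^sup>2 * indicator (?C k) t \<partial>lborel) = (\<phi> j (real k / real p))\<^sup>2 / real p"
    if "k \<in> {1..n * p}" for k
    using grid_cell_bounds[OF p that] by (simp add: diff_divide_distrib)
  have "(LINT t:{0..real n}|lborel. (step_basis n p \<phi> j t)\<^sup>2) =
      (\<Sum>k = 1..n * p. (\<phi> j (real k / real p))\<^sup>2 / real p)"
    unfolding set_lebesgue_integral_def eq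
    by (subst Bochner_Integration.integral_sum, rule int, assumption, rule sum.cong[OF refl], rule cell)
  also have "\<dots> = real n * (\<Sum>k = 1..p. (\<phi> j (real k / real p))\<^sup>2 / real p)"
    by (rule sum_periodic) (simp only: grid_periodic[OF grid_basisD(1)[OF basis j] p])
  also have "(\<Sum>k = 1..p. (\<phi> j (real k / real p))\<^sup>2 / real p) = 1"
    using grid_basisD(2)[OF basis j j] p by (simp add: sum_divide_distrib[symmetric] power2_eq_square)
  finally show "(LINT t:{0..real n}|lborel. (step_basis n p \<phi> j t)\<^sup>2) = real n" by simp
qed

text \<open>The integral of the step function against a single path \<open>x\<close>, as a sum of
  increments. It depends on the path alone, whereas \<open>stoch_integral\<close> depends on the
  measure and is determined only almost surely.\<close>

definition grid_noise :: "nat \<Rightarrow> nat \<Rightarrow> (nat \<Rightarrow> real \<Rightarrow> real) \<Rightarrow> nat \<Rightarrow> (real \<Rightarrow> real) \<Rightarrow> real" where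
  "grid_noise n p \<phi> j x =
    (\<Sum>k = 1..n * p. \<phi> j (real k / real p) * (x (real k / real p) - x ((real k - 1) / real p)))"

text \<open>The identity is pathwise, valid for any function \<open>x\<close>. Increments of the
  drift are cell integrals, and by periodicity the \<open>n * p\<close> of them repeat the first
  \<open>p\<close> exactly \<open>n\<close> times, which cancels the division by
  \<open>n\<close>.\<close>

lemma theta_hat_signal_plus_noise:
  assumes S: "S \<in> signal_class L r" and basis: "grid_basis p \<phi> \<phi>s" and n: "n \<ge> 1" and j: "j \<in> {1..p}"
  shows "theta_hat n p \<phi> (\<lambda>t\<in>{0..real n}. (LINT s:{0..t}|lborel. S s) + x t) j =
    theta_bar p \<phi> S j + grid_noise n p \<phi> j x / real n"
proof -
  have p: "p \<ge> 1" using j by simp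
  have Sm: "S \<in> borel_measurable borel" and per: "one_periodic S"
    using S by (auto simp: signal_class_def L2_on_def)
  obtain B where B: "\<And>t. \<bar>S t\<bar> \<le> B" using signal_class_bounded[OF S] by blast
  let ?y = "\<lambda>t\<in>{0..real n}. (LINT s:{0..t}|lborel. S s) + x t"
  have "?y (real k / real p) - ?y ((real k - 1) / real p) =
      cell_integral p S k + (x (real k / real p) - x ((real k - 1) / real p))" if k: "k \<in> {1..n * p}" for k
    using grid_cell_bounds[OF p k] set_integral_Icc_diff[OF Sm B grid_cell_bounds(1,2)[OF p k]]
    by (simp add: cell_integral_def)
  hence "theta_hat n p \<phi> ?y j = (\<Sum>k = 1..n * p. \<phi> j (real k / real p) *
      (cell_integral p S k + (x (real k / real p) - x ((real k - 1) / real p)))) / real n"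
    unfolding theta_hat_def by (intro arg_cong2[where f = "(/)"] sum.cong) auto
  also have "\<dots> = ((\<Sum>k = 1..n * p. \<phi> j (real k / real p) * cell_integral p S k) + grid_noise n p \<phi> j x) / real n"
    by (simp add: grid_noise_def distrib_left sum.distrib)
  also have "(\<Sum>k = 1..n * p. \<phi> j (real k / real p) * cell_integral p S k) = real n * theta_bar p \<phi> S j"
    unfolding theta_bar_def
    by (rule sum_periodic)
       (simp only: grid_periodic[OF grid_basisD(1)[OF basis j] p] cell_integral_periodic[OF per p])
  also have "(real n * theta_bar p \<phi> S j + grid_noise n p \<phi> j x) / real n =
      theta_bar p \<phi> S j + grid_noise n p \<phi> j x / real n"
    using n by (simp add: add_divide_distrib)
  finally show ?thesis .
qed

text \<open>Collects what the risk computation needs from the semimartingale model: the coefficients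
  are almost surely explicit increments of the path, and their second moments are controlled by
  \<open>\<kappa> Q\<close>.\<close>

lemma xi_coeff_props:
  assumes model: "noise_model (real n) \<Omega> \<xi> \<Q> \<kappa>" and Q: "Q \<in> \<Q>"
    and basis: "grid_basis p \<phi> \<phi>s" and n: "n \<ge> 1" and j: "j \<in> {1..p}"
  shows "AE \<omega> in Q. xi_coeff n p \<phi> Q \<xi> j \<omega> = grid_noise n p \<phi> j (\<lambda>t. \<xi> t \<omega>) / sqrt (real n)"
    and "integrable Q (xi_coeff n p \<phi> Q \<xi> j)"
    and "integrable Q (\<lambda>\<omega>. (xi_coeff n p \<phi> Q \<xi> j \<omega>)\<^sup>2)"
    and "(\<integral>\<omega>. (xi_coeff n p \<phi> Q \<xi> j \<omega>)\<^sup>2 \<partial>Q) \<le> \<kappa> Q"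
proof -
  have p: "p \<ge> 1" using j by simp
  let ?I = "stoch_integral Q (real n) \<xi> (step_basis n p \<phi> j)"
  have PQ: "prob_space Q" using model Q unfolding noise_model_def by blast
  note L2 = step_basis_L2[OF basis j]
  have "\<forall>f. L2_on 0 (real n) f \<longrightarrow>
           (\<exists>Y. has_stoch_integral Q (real n) \<xi> f Y) \<and>
           integrable Q (stoch_integral Q (real n) \<xi> f) \<and>
           integrable Q (\<lambda>\<omega>. (stoch_integral Q (real n) \<xi> f \<omega>)\<^sup>2) \<and>
           (\<integral>\<omega>. stoch_integral Q (real n) \<xi> f \<omega> \<partial>Q) = 0 \<and>
           (\<integral>\<omega>. (stoch_integral Q (real n) \<xi> f \<omega>)\<^sup>2 \<partial>Q)
             \<le> \<kappa> Q * (LINT s:{0..real n}|lborel. (f s)\<^sup>2)"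
    using model Q unfolding noise_model_def by blast
  from this[rule_format, OF L2(1)] have ex: "\<exists>Y. has_stoch_integral Q (real n) \<xi> (step_basis n p \<phi> j) Y"
    and int: "integrable Q ?I" "integrable Q (\<lambda>\<omega>. (?I \<omega>)\<^sup>2)"
    and le: "(\<integral>\<omega>. (?I \<omega>)\<^sup>2 \<partial>Q) \<le> \<kappa> Q * real n"
    unfolding L2(2) by auto
  have sb: "step_basis n p \<phi> j = (\<lambda>x. \<Sum>k\<in>{1..n * p}. \<phi> j (real k / real p) *
      indicator {(real k - 1) / real p <.. real k / real p} x)"
    by (simp add: step_basis_def fun_eq_iff)
  have "AE \<omega> in Q. ?I \<omega> = grid_noise n p \<phi> j (\<lambda>t. \<xi> t \<omega>)"
    unfolding grid_noise_def sb
    by (rule stoch_integral_step[OF PQ finite_atLeastAtMost _ ex[unfolded sb]])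
       (use grid_cell_bounds[OF p] in blast)
  thus "AE \<omega> in Q. xi_coeff n p \<phi> Q \<xi> j \<omega> = grid_noise n p \<phi> j (\<lambda>t. \<xi> t \<omega>) / sqrt (real n)"
    by eventually_elim (simp add: xi_coeff_def)
  show "integrable Q (xi_coeff n p \<phi> Q \<xi> j)"
    using int(1) unfolding xi_coeff_def[abs_def] by simp
  have sq: "(xi_coeff n p \<phi> Q \<xi> j \<omega>)\<^sup>2 = (?I \<omega>)\<^sup>2 / real n" for \<omega>
    by (simp add: xi_coeff_def power_divide)
  show "integrable Q (\<lambda>\<omega>. (xi_coeff n p \<phi> Q \<xi> j \<omega>)\<^sup>2)"
    unfolding sq using int(2) by simp
  show "(\<integral>\<omega>. (xi_coeff n p \<phi> Q \<xi> j \<omega>)\<^sup>2 \<partial>Q) \<le> \<kappa> Q"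
    unfolding sq using le n by (simp add: divide_le_eq)
qed

lemma theta_hat_measurable:
  assumes p: "p \<ge> 1"
  shows "(\<lambda>y. theta_hat n p \<phi> y j) \<in> borel_measurable (PiM {0..real n} (\<lambda>_. borel))"
proof -
  have c: "(\<lambda>y. y t) \<in> borel_measurable (PiM {0..real n} (\<lambda>_. borel :: real measure))" if "t \<in> {0..real n}" for t
    using that by (rule measurable_component_singleton)
  show ?thesis
    unfolding theta_hat_def
    by (intro borel_measurable_divide borel_measurable_sum borel_measurable_times borel_measurable_diff
        borel_measurable_const c) (use grid_cell_bounds[OF p] in fastforce)+
qed

section \<open>The risk of shrinkage\<close>

lemma dnorm_eq_L2_set: "dnorm d x = L2_set x {1..d}"
  by (simp add: dnorm_def L2_set_def)

lemma dnorm_nonneg: "0 \<le> dnorm d x"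
  by (simp add: dnorm_eq_L2_set)

lemma dnorm_power2: "(dnorm d x)\<^sup>2 = (\<Sum>i = 1..d. (x i)\<^sup>2)"
  by (simp add: dnorm_def sum_nonneg)

lemma abs_le_dnorm: "i \<in> {1..d} \<Longrightarrow> \<bar>x i\<bar> \<le> dnorm d x"
  using member_le_L2_set[of "{1..d}" i "\<lambda>i. \<bar>x i\<bar>"] by (simp add: dnorm_eq_L2_set L2_set_def)

lemma dnorm_cong: "(\<And>j. j \<in> {1..d} \<Longrightarrow> x j = y j) \<Longrightarrow> dnorm d x = dnorm d y"
  unfolding dnorm_def by (auto intro!: sum.cong)

lemma dnorm_le_const:
  assumes "\<And>j. j \<in> {1..d} \<Longrightarrow> \<bar>x j\<bar> \<le> B" and "0 \<le> B"
  shows "dnorm d x \<le> sqrt (real d) * B"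
proof -
  have "(\<Sum>j = 1..d. (x j)\<^sup>2) \<le> (\<Sum>j = 1..d. B\<^sup>2)"
    using assms by (intro sum_mono) (auto simp: abs_le_square_iff[symmetric])
  hence "dnorm d x \<le> sqrt (real d * B\<^sup>2)"
    unfolding dnorm_def by (intro real_sqrt_le_mono) simp
  thus ?thesis using assms(2) by (simp add: real_sqrt_mult)
qed

section \<open>Gain and risk for a general square integrable noise vector\<close>

context prob_space
begin

text \<open>The hypothesis \<open>reg\<close> reduces the gain to a lower bound for the mean of
  \<open>1 / s\<close>. Since \<open>s\<close> has mean at most
  \<open>R + a + sqrt \<epsilon>\<close>, convexity of the reciprocal gives that bound. The limit
  \<open>\<epsilon> \<rightarrow> 0\<close> is dominated by the sum of the
  \<open>\<bar>Z i\<bar>\<close>, uniformly in \<open>\<epsilon>\<close>.\<close>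

lemma shrinkage_gain:
  fixes Z :: "nat \<Rightarrow> 'a \<Rightarrow> real" and b :: "nat \<Rightarrow> real"
  defines "X \<equiv> \<lambda>\<omega> i. b i + Z i \<omega>"
  assumes meas [measurable]: "\<And>i. i \<in> {1..d} \<Longrightarrow> Z i \<in> borel_measurable M"
    and int2: "\<And>i. i \<in> {1..d} \<Longrightarrow> integrable M (\<lambda>\<omega>. (Z i \<omega>)\<^sup>2)"
    and R: "dnorm d b \<le> R" "0 < R" and a: "0 < a" "(\<Sum>i = 1..d. expectation (\<lambda>\<omega>. (Z i \<omega>)\<^sup>2)) \<le> a\<^sup>2"
    and l: "0 \<le> l"
    and reg: "\<And>\<epsilon>. 0 < \<epsilon> \<Longrightarrow>
      0 \<le> expectation (\<lambda>\<omega>. ((\<Sum>i = 1..d. X \<omega> i * Z i \<omega>) - l) / sqrt ((dnorm d (X \<omega>))\<^sup>2 + \<epsilon>))"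
  shows "l / (R + a) \<le> expectation (\<lambda>\<omega>. (\<Sum>i = 1..d. X \<omega> i * Z i \<omega>) / dnorm d (X \<omega>))"
proof -
  let ?N = "\<lambda>\<omega>. dnorm d (X \<omega>)"
  define s where "s = (\<lambda>\<epsilon> \<omega>. sqrt ((?N \<omega>)\<^sup>2 + \<epsilon>))"
  define P where "P = (\<lambda>\<omega>. \<Sum>i = 1..d. X \<omega> i * Z i \<omega>)"
  have X_meas [measurable]: "(\<lambda>\<omega>. X \<omega> i) \<in> borel_measurable M" if "i \<in> {1..d}" for i
    unfolding X_def using that by measurable
  have N_meas [measurable]: "?N \<in> borel_measurable M"
    unfolding dnorm_def by measurable
  have s_meas [measurable]: "s \<epsilon> \<in> borel_measurable M" for \<epsilon>
    unfolding s_def by measurable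
  have P_meas [measurable]: "P \<in> borel_measurable M"
    unfolding P_def by measurable
  have int: "integrable M (Z i)" if "i \<in> {1..d}" for i
    using square_integrable_imp_integrable[OF meas[OF that] int2[OF that]] .
  have int_sum: "integrable M (\<lambda>\<omega>. \<Sum>i = 1..d. \<bar>Z i \<omega>\<bar>)"
    by (intro Bochner_Integration.integrable_sum integrable_abs int)
  have s_pos: "0 < s \<epsilon> \<omega>" and s_ge: "?N \<omega> \<le> s \<epsilon> \<omega>" "sqrt \<epsilon> \<le> s \<epsilon> \<omega>" if "0 < \<epsilon>" for \<epsilon> \<omega>
    using that by (auto simp: s_def add_nonneg_pos intro!: real_le_rsqrt real_sqrt_le_mono)
  have P_le: "\<bar>P \<omega>\<bar> \<le> ?N \<omega> * (\<Sum>i = 1..d. \<bar>Z i \<omega>\<bar>)" for \<omega>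
    unfolding P_def sum_distrib_left
    by (intro order_trans[OF sum_abs] sum_mono) (auto simp: abs_mult intro!: mult_right_mono abs_le_dnorm)
  have quot: "\<bar>P \<omega> / s \<epsilon> \<omega>\<bar> \<le> (\<Sum>i = 1..d. \<bar>Z i \<omega>\<bar>)" if "0 < \<epsilon>" for \<epsilon> \<omega>
  proof -
    have "\<bar>P \<omega>\<bar> \<le> s \<epsilon> \<omega> * (\<Sum>i = 1..d. \<bar>Z i \<omega>\<bar>)"
      by (rule order_trans[OF P_le]) (intro mult_right_mono s_ge that sum_nonneg abs_ge_zero)
    thus ?thesis using s_pos[OF that, of \<omega>] by (simp add: field_simps)
  qed
  have int_Ps: "integrable M (\<lambda>\<omega>. P \<omega> / s \<epsilon> \<omega>)" if "0 < \<epsilon>" for \<epsilon>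
    by (rule Bochner_Integration.integrable_bound[OF int_sum])
       (use quot[OF that] in \<open>auto intro: order_trans[OF _ abs_ge_self]\<close>)
  have int_1s: "integrable M (\<lambda>\<omega>. 1 / s \<epsilon> \<omega>)" if "0 < \<epsilon>" for \<epsilon>
  proof (rule integrable_const_bound[where B = "1 / sqrt \<epsilon>"])
    show "AE \<omega> in M. norm (1 / s \<epsilon> \<omega>) \<le> 1 / sqrt \<epsilon>"
      using s_pos[OF that] s_ge(2)[OF that] that by (auto simp: less_imp_le intro!: divide_left_mono)
  qed measurable
  have Z2: "integrable M (\<lambda>\<omega>. \<Sum>i = 1..d. (Z i \<omega>)\<^sup>2)"
    by (intro Bochner_Integration.integrable_sum int2)
  have lower: "l / (R + a + sqrt \<epsilon>) \<le> expectation (\<lambda>\<omega>. P \<omega> / s \<epsilon> \<omega>)" if \<epsilon>: "0 < \<epsilon>" for \<epsilon>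
  proof -
    define m where "m = R + a + sqrt \<epsilon>"
    \<comment> \<open>An upper bound for \<open>s \<epsilon>\<close> that is affine in
      \<open>|Z|^2\<close>: the norm \<open>|Z|\<close> is replaced by
      \<open>(|Z|^2 / a + a) / 2\<close>, which has mean at most \<open>a\<close> by the second
      moment hypothesis.\<close>
    define q where "q = (\<lambda>\<omega>. R + ((\<Sum>i = 1..d. (Z i \<omega>)\<^sup>2) / a + a) / 2 + sqrt \<epsilon>)"
    have m: "0 < m" using R a \<epsilon> by (simp add: m_def add_pos_nonneg)
    have s_q: "s \<epsilon> \<omega> \<le> q \<omega>" for \<omega>
    proof -
      have "s \<epsilon> \<omega> \<le> ?N \<omega> + sqrt \<epsilon>"
        unfolding s_def using \<epsilon> by (intro order_trans[OF sqrt_add_le_add_sqrt]) (auto simp: dnorm_nonneg)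
      moreover have "?N \<omega> \<le> dnorm d b + dnorm d (\<lambda>i. Z i \<omega>)"
        unfolding dnorm_eq_L2_set X_def by (rule L2_set_triangle_ineq)
      moreover have "dnorm d (\<lambda>i. Z i \<omega>) \<le> ((dnorm d (\<lambda>i. Z i \<omega>))\<^sup>2 / a + a) / 2"
        using a(1) sum_squares_bound[of "dnorm d (\<lambda>i. Z i \<omega>)" a]
        by (simp add: field_simps power2_eq_square)
      ultimately show ?thesis using R unfolding q_def dnorm_power2 by linarith
    qed
    have int_q: "integrable M q" unfolding q_def using Z2 by auto
    have "expectation q = R + ((\<Sum>i = 1..d. expectation (\<lambda>\<omega>. (Z i \<omega>)\<^sup>2)) / a + a) / 2 + sqrt \<epsilon>"
      unfolding q_def using Z2 int2 by (simp add: prob_space Bochner_Integration.integral_sum)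
    also have "\<dots> \<le> R + (a\<^sup>2 / a + a) / 2 + sqrt \<epsilon>"
      using a by (intro add_mono divide_right_mono order_refl) auto
    also have "\<dots> = m" using a by (simp add: m_def power2_eq_square)
    finally have E_q: "expectation q \<le> m" .
    have "2 / m - m / m\<^sup>2 \<le> 2 / m - expectation q / m\<^sup>2"
      using E_q by (intro diff_left_mono divide_right_mono) auto
    also have "\<dots> = expectation (\<lambda>\<omega>. 2 / m - q \<omega> / m\<^sup>2)"
      using int_q by (simp add: prob_space)
    also have "\<dots> \<le> expectation (\<lambda>\<omega>. 1 / s \<epsilon> \<omega>)"
    proof (rule integral_mono)
      fix \<omega>
      \<comment> \<open>Jensen's inequality by hand: the tangent of the reciprocal at
        \<open>m\<close> lies below it, that is \<open>1 / s \<ge> 2 / m - s / m^2\<close>.\<close>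
      have "0 \<le> (s \<epsilon> \<omega> - m)\<^sup>2" by simp
      hence "(2 * m - s \<epsilon> \<omega>) * s \<epsilon> \<omega> \<le> m\<^sup>2" by (simp add: power2_eq_square algebra_simps)
      hence "(2 * m - s \<epsilon> \<omega>) / m\<^sup>2 \<le> 1 / s \<epsilon> \<omega>"
        using m s_pos[OF \<epsilon>, of \<omega>] by (simp add: field_simps)
      moreover have "(2 * m - s \<epsilon> \<omega>) / m\<^sup>2 = 2 / m - s \<epsilon> \<omega> / m\<^sup>2"
        using m by (simp add: field_simps power2_eq_square)
      moreover have "s \<epsilon> \<omega> / m\<^sup>2 \<le> q \<omega> / m\<^sup>2"
        using s_q by (intro divide_right_mono) auto
      ultimately show "2 / m - q \<omega> / m\<^sup>2 \<le> 1 / s \<epsilon> \<omega>" by linarith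
    qed (use int_q int_1s[OF \<epsilon>] in auto)
    finally have "1 / m \<le> expectation (\<lambda>\<omega>. 1 / s \<epsilon> \<omega>)"
      using m by (simp add: power2_eq_square)
    hence "l * (1 / m) \<le> l * expectation (\<lambda>\<omega>. 1 / s \<epsilon> \<omega>)"
      using l by (rule mult_left_mono)
    also have "\<dots> \<le> expectation (\<lambda>\<omega>. P \<omega> / s \<epsilon> \<omega>)"
    proof -
      have "0 \<le> expectation (\<lambda>\<omega>. P \<omega> / s \<epsilon> \<omega> - l * (1 / s \<epsilon> \<omega>))"
        using reg[OF \<epsilon>] by (simp add: P_def s_def diff_divide_distrib)
      thus ?thesis
        using Bochner_Integration.integral_diff[OF int_Ps[OF \<epsilon>] integrable_mult_right[OF int_1s[OF \<epsilon>], of l]]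
          integral_mult_right_zero[of M l "\<lambda>\<omega>. 1 / s \<epsilon> \<omega>"]
        by linarith
    qed
    finally show ?thesis by (simp add: m_def)
  qed
  define e where "e = (\<lambda>k. 1 / real (Suc k))"
  have e: "0 < e k" "e \<longlonglongrightarrow> 0" for k
    unfolding e_def using LIMSEQ_inverse_real_of_nat by (auto simp: inverse_eq_divide)
  have "(\<lambda>k. expectation (\<lambda>\<omega>. P \<omega> / s (e k) \<omega>)) \<longlonglongrightarrow> expectation (\<lambda>\<omega>. P \<omega> / ?N \<omega>)"
  proof (rule integral_dominated_convergence[OF _ _ int_sum])
    show "AE \<omega> in M. (\<lambda>k. P \<omega> / s (e k) \<omega>) \<longlonglongrightarrow> P \<omega> / ?N \<omega>"
    proof (intro AE_I2)
      fix \<omega>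
      show "(\<lambda>k. P \<omega> / s (e k) \<omega>) \<longlonglongrightarrow> P \<omega> / ?N \<omega>"
      proof (cases "?N \<omega> = 0")
        \<comment> \<open>Here \<open>P \<omega>\<close> vanishes too, so every term is zero and so
          is the limit, division by zero being zero.\<close>
        case True
        thus ?thesis using P_le[of \<omega>] by simp
      next
        case False
        have "(\<lambda>k. P \<omega> / sqrt ((?N \<omega>)\<^sup>2 + e k)) \<longlonglongrightarrow> P \<omega> / sqrt ((?N \<omega>)\<^sup>2 + 0)"
          using False by (intro tendsto_intros e) auto
        thus ?thesis by (simp add: s_def dnorm_nonneg)
      qed
    qed
  qed (use quot[OF e(1)] in auto)
  moreover have "(\<lambda>k. l / (R + a + sqrt (e k))) \<longlonglongrightarrow> l / (R + a + sqrt 0)"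
    using R a by (intro tendsto_intros e) auto
  ultimately show ?thesis
    using lower[OF e(1)] unfolding P_def by (intro LIMSEQ_le[of _ "l / (R + a)"]) auto
qed

text \<open>With \<open>k = c / |X|\<close> the squared errors differ by \<open>k^2 |X|^2\<close>
  minus \<open>2 k\<close> times the inner product of \<open>X\<close> with \<open>X - t\<close>.
  The first term is at most \<open>c^2\<close>. Splitting \<open>X - t\<close> into the noise
  \<open>Z\<close> and the bias \<open>b - t\<close> yields the gain and, by Cauchy-Schwarz, a
  remainder of at most \<open>2 c e\<close>.\<close>

lemma shrinkage_risk:
  fixes Z :: "nat \<Rightarrow> 'a \<Rightarrow> real" and b t :: "nat \<Rightarrow> real"
  defines "X \<equiv> \<lambda>\<omega> i. b i + Z i \<omega>"
  assumes meas [measurable]: "\<And>i. i \<in> {1..d} \<Longrightarrow> Z i \<in> borel_measurable M"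
    and int2: "\<And>i. i \<in> {1..d} \<Longrightarrow> integrable M (\<lambda>\<omega>. (Z i \<omega>)\<^sup>2)"
    and c: "0 \<le> c" and bias: "dnorm d (\<lambda>i. b i - t i) \<le> e"
  shows "expectation (\<lambda>\<omega>. (dnorm d (\<lambda>i. (1 - c / dnorm d (X \<omega>)) * X \<omega> i - t i))\<^sup>2) -
      expectation (\<lambda>\<omega>. (dnorm d (\<lambda>i. X \<omega> i - t i))\<^sup>2) \<le>
    c\<^sup>2 + 2 * c * e - 2 * c * expectation (\<lambda>\<omega>. (\<Sum>i = 1..d. X \<omega> i * Z i \<omega>) / dnorm d (X \<omega>))"
proof -
  let ?N = "\<lambda>\<omega>. dnorm d (X \<omega>)"
  let ?Y = "\<lambda>\<omega> i. (1 - c / ?N \<omega>) * X \<omega> i"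
  let ?P = "\<lambda>\<omega>. (\<Sum>i = 1..d. X \<omega> i * Z i \<omega>) / ?N \<omega>"
  have X_meas [measurable]: "(\<lambda>\<omega>. X \<omega> i) \<in> borel_measurable M" if "i \<in> {1..d}" for i
    unfolding X_def using that by measurable
  have N_meas [measurable]: "?N \<in> borel_measurable M"
    unfolding dnorm_def by measurable
  have e: "0 \<le> e" using bias dnorm_nonneg order_trans by blast
  have int: "integrable M (Z i)" if "i \<in> {1..d}" for i
    using square_integrable_imp_integrable[OF meas[OF that] int2[OF that]] .
  have int_X: "integrable M (\<lambda>\<omega>. (X \<omega> i - t i)\<^sup>2)" if "i \<in> {1..d}" for i
  proof -
    have "(X \<omega> i - t i)\<^sup>2 = (Z i \<omega>)\<^sup>2 + 2 * (b i - t i) * Z i \<omega> + (b i - t i)\<^sup>2" for \<omega>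
      by (simp add: X_def power2_eq_square algebra_simps)
    thus ?thesis using int2[OF that] int[OF that] by simp
  qed
  have Nq: "\<bar>X \<omega> i / ?N \<omega>\<bar> \<le> 1" if "i \<in> {1..d}" for \<omega> i
    using abs_le_dnorm[OF that, of "X \<omega>"] dnorm_nonneg[of d "X \<omega>"] by (simp add: divide_le_eq)
  have sq: "(u - v)\<^sup>2 \<le> 2 * u\<^sup>2 + 2 * v\<^sup>2" for u v :: real
    using zero_le_power2[of "u + v"] by (simp add: power2_eq_square algebra_simps)
  have int_Y: "integrable M (\<lambda>\<omega>. (?Y \<omega> i - t i)\<^sup>2)" if i: "i \<in> {1..d}" for i
  proof (rule Bochner_Integration.integrable_bound)
    show "integrable M (\<lambda>\<omega>. 2 * (X \<omega> i - t i)\<^sup>2 + 2 * c\<^sup>2)"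
      using int_X[OF i] by simp
    have "(?Y \<omega> i - t i)\<^sup>2 \<le> 2 * (X \<omega> i - t i)\<^sup>2 + 2 * c\<^sup>2" for \<omega>
    proof -
      let ?u = "X \<omega> i - t i" and ?v = "c * (X \<omega> i / ?N \<omega>)"
      have eq: "?Y \<omega> i - t i = ?u - ?v" by (simp add: algebra_simps)
      have 1: "(?u - ?v)\<^sup>2 \<le> 2 * ?u\<^sup>2 + 2 * ?v\<^sup>2"
        by (rule sq)
      have 2: "?v\<^sup>2 \<le> c\<^sup>2"
        unfolding power_mult_distrib using Nq[OF i, of \<omega>]
        by (intro mult_left_le zero_le_power2) (simp only: abs_square_le_1)
      show ?thesis unfolding eq using 1 2 by linarith
    qed
    thus "AE \<omega> in M. norm ((?Y \<omega> i - t i)\<^sup>2) \<le> norm (2 * (X \<omega> i - t i)\<^sup>2 + 2 * c\<^sup>2)"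
      by simp
  qed (use i in measurable)
  have int_P: "integrable M ?P"
  proof (rule Bochner_Integration.integrable_bound)
    show "integrable M (\<lambda>\<omega>. \<Sum>i = 1..d. \<bar>Z i \<omega>\<bar>)"
      by (intro Bochner_Integration.integrable_sum integrable_abs int)
    have "\<bar>?P \<omega>\<bar> \<le> (\<Sum>i = 1..d. \<bar>Z i \<omega>\<bar>)" for \<omega>
    proof -
      have "\<bar>?P \<omega>\<bar> \<le> (\<Sum>i = 1..d. \<bar>X \<omega> i / ?N \<omega>\<bar> * \<bar>Z i \<omega>\<bar>)"
        unfolding sum_divide_distrib by (rule order_trans[OF sum_abs]) (simp add: abs_mult)
      also have "\<dots> \<le> (\<Sum>i = 1..d. \<bar>Z i \<omega>\<bar>)"
        by (intro sum_mono mult_left_le_one_le Nq) auto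
      finally show ?thesis .
    qed
    thus "AE \<omega> in M. norm (?P \<omega>) \<le> norm (\<Sum>i = 1..d. \<bar>Z i \<omega>\<bar>)"
      by (simp add: sum_nonneg)
  qed measurable
  have int_D: "integrable M (\<lambda>\<omega>. (dnorm d (\<lambda>i. ?Y \<omega> i - t i))\<^sup>2)"
      "integrable M (\<lambda>\<omega>. (dnorm d (\<lambda>i. X \<omega> i - t i))\<^sup>2)"
    unfolding dnorm_power2 by (intro Bochner_Integration.integrable_sum int_Y int_X; assumption)+
  have alg: "((1 - k) * x - u)\<^sup>2 - (x - u)\<^sup>2 = k\<^sup>2 * x\<^sup>2 - 2 * k * (x * z) - 2 * k * (x * (v - u))"
    if "x = v + z" for k x u v z :: real
    unfolding that by (simp add: power2_eq_square algebra_simps)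
  have pt: "(dnorm d (\<lambda>i. ?Y \<omega> i - t i))\<^sup>2 - (dnorm d (\<lambda>i. X \<omega> i - t i))\<^sup>2 \<le>
      c\<^sup>2 + 2 * c * e - 2 * c * ?P \<omega>" for \<omega>
  proof (cases "?N \<omega> = 0")
    \<comment> \<open>Since \<open>c / 0 = 0\<close>, the shrunken vector equals \<open>X\<close>
      and the left-hand side is zero; the quotient on the right is zero as well, so \<open>c\<close>
      and \<open>e\<close> being nonnegative suffices.\<close>
    case True
    thus ?thesis using c e
      by simp
  next
    case False
    hence N: "0 < ?N \<omega>" using dnorm_nonneg[of d "X \<omega>"] by simp
    let ?n = "?N \<omega>"
    have "(dnorm d (\<lambda>i. ?Y \<omega> i - t i))\<^sup>2 - (dnorm d (\<lambda>i. X \<omega> i - t i))\<^sup>2 =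
        (\<Sum>i = 1..d. (c / ?n)\<^sup>2 * (X \<omega> i)\<^sup>2 - 2 * (c / ?n) * (X \<omega> i * Z i \<omega>)
           - 2 * (c / ?n) * (X \<omega> i * (b i - t i)))"
      unfolding dnorm_power2 sum_subtractf[symmetric]
      by (intro sum.cong refl alg) (simp add: X_def)
    also have "\<dots> = (c / ?n)\<^sup>2 * ?n\<^sup>2 - 2 * (c / ?n) * (\<Sum>i = 1..d. X \<omega> i * Z i \<omega>)
        - 2 * (c / ?n) * (\<Sum>i = 1..d. X \<omega> i * (b i - t i))"
      by (simp only: sum_subtractf sum_distrib_left[symmetric] dnorm_power2)
    also have "(c / ?n)\<^sup>2 * ?n\<^sup>2 = c\<^sup>2" using N by (simp add: power_divide)
    also have "2 * (c / ?n) * (\<Sum>i = 1..d. X \<omega> i * Z i \<omega>) = 2 * c * ?P \<omega>" by simp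
    finally have eq: "(dnorm d (\<lambda>i. ?Y \<omega> i - t i))\<^sup>2 - (dnorm d (\<lambda>i. X \<omega> i - t i))\<^sup>2 =
        c\<^sup>2 - 2 * c * ?P \<omega> - 2 * (c / ?n) * (\<Sum>i = 1..d. X \<omega> i * (b i - t i))" .
    have "- (\<Sum>i = 1..d. X \<omega> i * (b i - t i)) \<le> (\<Sum>i = 1..d. \<bar>X \<omega> i\<bar> * \<bar>b i - t i\<bar>)"
      unfolding sum_negf[symmetric] abs_mult[symmetric] by (intro sum_mono) (rule abs_ge_minus_self)
    also have "\<dots> \<le> ?n * dnorm d (\<lambda>i. b i - t i)"
      unfolding dnorm_eq_L2_set by (rule L2_set_mult_ineq)
    also have "\<dots> \<le> ?n * e" using bias N by (intro mult_left_mono) auto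
    finally have "2 * (c / ?n) * (- (\<Sum>i = 1..d. X \<omega> i * (b i - t i))) \<le> 2 * (c / ?n) * (?n * e)"
      using c N by (intro mult_left_mono) auto
    also have "\<dots> = 2 * c * e" using N by simp
    finally show ?thesis unfolding eq by simp
  qed
  have "expectation (\<lambda>\<omega>. (dnorm d (\<lambda>i. ?Y \<omega> i - t i))\<^sup>2 - (dnorm d (\<lambda>i. X \<omega> i - t i))\<^sup>2) \<le>
      expectation (\<lambda>\<omega>. c\<^sup>2 + 2 * c * e - 2 * c * ?P \<omega>)"
    by (intro integral_mono pt Bochner_Integration.integrable_diff integrable_const integrable_mult_right int_D int_P)
  moreover have "expectation (\<lambda>\<omega>. c\<^sup>2 + 2 * c * e) = c\<^sup>2 + 2 * c * e" by (simp add: prob_space)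
  ultimately show ?thesis
    using Bochner_Integration.integral_diff[OF int_D]
      Bochner_Integration.integral_diff[OF integrable_const integrable_mult_right[OF int_P, of "2 * c"], of "c\<^sup>2 + 2 * c * e"]
      integral_mult_right_zero[of M "2 * c" ?P]
    by linarith
qed

end

text \<open>Applies the Gaussian inequality to the conditional law at almost every outcome, with
  \<open>\<Lambda>\<close> the largest eigenvalue of the conditional covariance there, and averages.
  The real work is the lower bound and the integrability that the averaging demands.\<close>

lemma conditionally_gaussian_shrinkage_inequality:
  fixes Z :: "nat \<Rightarrow> 'a \<Rightarrow> real" and b :: "nat \<Rightarrow> real" and \<sigma> :: real
  defines "X \<equiv> \<lambda>\<omega> i. b i + \<sigma> * Z i \<omega>"
  assumes Q: "prob_space Q" and F: "subalgebra Q F" and gauss: "conditionally_gaussian Q F d Z"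
    and gap: "AE \<omega> in Q. l \<le> (\<Sum>i = 1..d. cond_cov Q F Z \<omega> i i) - lambda_max d (cond_cov Q F Z \<omega>)"
    and d: "d \<ge> 1" and l: "0 \<le> l" and \<sigma>: "0 < \<sigma>" and \<epsilon>: "0 < \<epsilon>"
    and int: "\<And>i. i \<in> {1..d} \<Longrightarrow> integrable Q (Z i)"
  shows "0 \<le> (\<integral>\<omega>. ((\<Sum>i = 1..d. X \<omega> i * Z i \<omega>) - \<sigma> * l) / sqrt ((dnorm d (X \<omega>))\<^sup>2 + \<epsilon>) \<partial>Q)"
proof -
  interpret prob_space Q by (rule Q)
  let ?N = "PiM {1..d} (\<lambda>_. borel :: real measure)"
  obtain K where K: "regular_conditional_law Q F ?N (\<lambda>\<omega>. \<lambda>j\<in>{1..d}. Z j \<omega>) K"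
    and KG: "AE \<omega> in Q. centered_gaussian d (cond_cov Q F Z \<omega>) (K \<omega>)"
    using gauss unfolding conditionally_gaussian_def by blast
  define s where "s = (\<lambda>z. sqrt ((\<Sum>i = 1..d. (b i + \<sigma> * z i)\<^sup>2) + \<epsilon>))"
  define h where "h = (\<lambda>z. ((\<Sum>i = 1..d. (b i + \<sigma> * z i) * z i) - \<sigma> * l) / s z)"
  have s_pos: "0 < s z" and s_ge: "sqrt \<epsilon> \<le> s z" for z
    using \<epsilon> by (auto simp: s_def intro!: real_sqrt_le_mono add_nonneg_pos sum_nonneg)
  have x_le: "\<bar>b i + \<sigma> * z i\<bar> \<le> s z" if "i \<in> {1..d}" for z i
  proof -
    have "(b i + \<sigma> * z i)\<^sup>2 \<le> (\<Sum>i = 1..d. (b i + \<sigma> * z i)\<^sup>2)"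
      using that by (intro member_le_sum) auto
    hence "sqrt ((b i + \<sigma> * z i)\<^sup>2) \<le> s z"
      unfolding s_def using \<epsilon> by (intro real_sqrt_le_mono) linarith
    thus ?thesis by simp
  qed
  have hm: "h \<in> borel_measurable ?N"
    unfolding h_def s_def by measurable
  have Zm [measurable]: "Z i \<in> borel_measurable Q" if "i \<in> {1..d}" for i
    using int[OF that] by auto
  have h_eq: "h (\<lambda>j\<in>{1..d}. Z j \<omega>) =
      ((\<Sum>i = 1..d. X \<omega> i * Z i \<omega>) - \<sigma> * l) / sqrt ((dnorm d (X \<omega>))\<^sup>2 + \<epsilon>)" for \<omega>
    by (simp add: h_def s_def X_def dnorm_power2)
  have sl: "\<sigma> * l / s z \<le> \<sigma> * l / sqrt \<epsilon>" for z
    using s_ge[of z] s_pos[of z] \<epsilon> \<sigma> l by (intro divide_left_mono) auto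
  have lb: "- ((\<Sum>i = 1..d. \<bar>b i\<bar> / \<sigma>) + \<sigma> * l / sqrt \<epsilon>) \<le> h z" for z
  proof -
    have "- (\<Sum>i = 1..d. \<bar>b i\<bar> / \<sigma>) \<le> (\<Sum>i = 1..d. (b i + \<sigma> * z i) * z i / s z)"
      unfolding sum_negf[symmetric]
    proof (rule sum_mono)
      fix i assume i: "i \<in> {1..d}"
      let ?x = "b i + \<sigma> * z i"
      have z: "z i = (?x - b i) / \<sigma>" using \<sigma> by simp
      have "?x * b i \<le> \<bar>?x\<bar> * \<bar>b i\<bar>" by (simp add: abs_mult[symmetric])
      also have "\<dots> \<le> s z * \<bar>b i\<bar>" using x_le[OF i] by (intro mult_right_mono) auto
      finally have "- (s z * \<bar>b i\<bar>) \<le> ?x * (?x - b i)"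
        using zero_le_square[of ?x] right_diff_distrib[of ?x ?x "b i"] by linarith
      hence "- (s z * \<bar>b i\<bar>) / (\<sigma> * s z) \<le> ?x * (?x - b i) / (\<sigma> * s z)"
        using \<sigma> s_pos[of z] by (intro divide_right_mono) auto
      also have "\<dots> = ?x * z i / s z" by (subst (3) z) simp
      finally show "- (\<bar>b i\<bar> / \<sigma>) \<le> ?x * z i / s z" using s_pos[of z] by simp
    qed
    thus ?thesis using sl[of z] by (simp add: h_def diff_divide_distrib sum_divide_distrib)
  qed
  have int_h: "integrable Q (\<lambda>\<omega>. h (\<lambda>j\<in>{1..d}. Z j \<omega>))"
  proof (rule Bochner_Integration.integrable_bound)
    show "integrable Q (\<lambda>\<omega>. (\<Sum>i = 1..d. \<bar>Z i \<omega>\<bar>) + \<sigma> * l / sqrt \<epsilon>)"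
      by (intro Bochner_Integration.integrable_add Bochner_Integration.integrable_sum integrable_abs int integrable_const)
    have X: "(\<lambda>\<omega>. \<lambda>j\<in>{1..d}. Z j \<omega>) \<in> measurable Q ?N"
      using K unfolding regular_conditional_law_def by blast
    show "(\<lambda>\<omega>. h (\<lambda>j\<in>{1..d}. Z j \<omega>)) \<in> borel_measurable Q"
      by (rule measurable_compose[OF X hm])
    have "\<bar>h (\<lambda>j\<in>{1..d}. Z j \<omega>)\<bar> \<le> (\<Sum>i = 1..d. \<bar>Z i \<omega>\<bar>) + \<sigma> * l / sqrt \<epsilon>" for \<omega>
    proof -
      let ?z = "\<lambda>j\<in>{1..d}. Z j \<omega>"
      have "\<bar>(\<Sum>i = 1..d. (b i + \<sigma> * ?z i) * ?z i / s ?z)\<bar> \<le> (\<Sum>i = 1..d. \<bar>Z i \<omega>\<bar>)"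
      proof (intro order_trans[OF sum_abs] sum_mono)
        fix i assume i: "i \<in> {1..d}"
        have "\<bar>b i + \<sigma> * ?z i\<bar> * \<bar>?z i\<bar> \<le> s ?z * \<bar>?z i\<bar>"
          by (intro mult_right_mono x_le[OF i] abs_ge_zero)
        moreover have "\<bar>?z i\<bar> = \<bar>Z i \<omega>\<bar>" using i by simp
        ultimately show "\<bar>(b i + \<sigma> * ?z i) * ?z i / s ?z\<bar> \<le> \<bar>Z i \<omega>\<bar>"
          using s_pos[of ?z] by (simp only: abs_mult abs_divide) (simp add: field_simps)
      qed
      moreover have "0 \<le> \<sigma> * l / s ?z" using \<sigma> l s_pos[of ?z] by simp
      moreover have "h ?z = (\<Sum>i = 1..d. (b i + \<sigma> * ?z i) * ?z i / s ?z) - \<sigma> * l / s ?z"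
        unfolding h_def by (simp only: diff_divide_distrib sum_divide_distrib)
      ultimately show ?thesis using sl[of ?z] by linarith
    qed
    thus "AE \<omega> in Q. norm (h (\<lambda>j\<in>{1..d}. Z j \<omega>)) \<le> norm ((\<Sum>i = 1..d. \<bar>Z i \<omega>\<bar>) + \<sigma> * l / sqrt \<epsilon>)"
      by (intro AE_I2) (auto intro: order_trans[OF _ abs_ge_self])
  qed
  have pos: "AE \<omega> in Q. integrable (K \<omega>) h \<and> 0 \<le> (\<integral>z. h z \<partial>K \<omega>)"
    using KG gap
  proof eventually_elim
    case (elim \<omega>)
    let ?G = "cond_cov Q F Z \<omega>"
    obtain A where A: "\<And>i j. i \<in> {1..d} \<Longrightarrow> j \<in> {1..d} \<Longrightarrow> (\<Sum>k = 1..d. A i k * A j k) = ?G i j"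
      using elim(1) unfolding centered_gaussian_def by blast
    have sym: "?G i j = ?G j i" if "i \<in> {1..d}" "j \<in> {1..d}" for i j
      using that by (simp add: A[symmetric] mult.commute)
    have ray: "(\<Sum>i = 1..d. \<Sum>j = 1..d. ?G i j * x i * x j) \<le> lambda_max d ?G * (\<Sum>i = 1..d. (x i)\<^sup>2)" for x
      using rayleigh_lambda_max[of d ?G x] sym d unfolding quad_form_def by blast
    have nn: "0 \<le> lambda_max d ?G" using A d by (rule lambda_max_nonneg)
    show ?case
      unfolding h_def s_def
      using gaussian_shrinkage_inequality[OF elim(1) ray elim(2) nn \<epsilon> less_imp_le[OF \<sigma>]] by blast
  qed
  have "0 \<le> (\<integral>\<omega>. h (\<lambda>j\<in>{1..d}. Z j \<omega>) \<partial>Q)"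
    by (rule regular_conditional_law_integral_nonneg[OF Q F K hm _ int_h pos]) (rule lb)
  thus ?thesis unfolding h_eq .
qed

section \<open>The risk of the estimator under the observation law\<close>

lemma risk_diff_eq:
  assumes model: "noise_model (real n) \<Omega> \<xi> \<Q> \<kappa>" and Q: "Q \<in> \<Q>"
    and basis: "grid_basis p \<phi> \<phi>s" and n: "n \<ge> 1" and p: "p \<ge> 1" and dp: "d \<le> p"
    and S: "S \<in> signal_class L r"
  defines "X \<equiv> \<lambda>\<omega> i. theta_bar p \<phi> S i + xi_coeff n p \<phi> Q \<xi> i \<omega> / sqrt (real n)"
  shows "risk_diff n p d \<phi> c \<xi> Q S =
    (\<integral>\<omega>. (dnorm d (\<lambda>i. (1 - c / dnorm d (X \<omega>)) * X \<omega> i - theta p \<phi> S i))\<^sup>2 \<partial>Q) -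
    (\<integral>\<omega>. (dnorm d (\<lambda>i. X \<omega> i - theta p \<phi> S i))\<^sup>2 \<partial>Q)"
proof -
  let ?P = "PiM {0..real n} (\<lambda>_. borel :: real measure)"
  let ?y = "\<lambda>\<omega>. \<lambda>t\<in>{0..real n}. (LINT s:{0..t}|lborel. S s) + \<xi> t \<omega>"
  let ?h = "theta_hat n p \<phi>" and ?t = "theta p \<phi> S"
  let ?A = "\<lambda>x. (dnorm d (\<lambda>i. (1 - c / dnorm d x) * x i - ?t i))\<^sup>2"
  let ?B = "\<lambda>x. (dnorm d (\<lambda>i. x i - ?t i))\<^sup>2"
  have "\<forall>t\<in>{0..real n}. \<xi> t \<in> borel_measurable Q"
    using model Q unfolding noise_model_def square_integrable_semimartingale_def by blast
  hence y: "?y \<in> measurable Q ?P"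
    by (intro measurable_restrict borel_measurable_add borel_measurable_const) blast
  note hm [measurable] = theta_hat_measurable[OF p]
  have Am: "(\<lambda>y. ?A (?h y)) \<in> borel_measurable ?P" and Bm: "(\<lambda>y. ?B (?h y)) \<in> borel_measurable ?P"
    unfolding dnorm_def by measurable
  have j: "i \<in> {1..p}" if "i \<in> {1..d}" for i using that dp by auto
  have Xm [measurable]: "(\<lambda>\<omega>. X \<omega> i) \<in> borel_measurable Q" if "i \<in> {1..d}" for i
    unfolding X_def using xi_coeff_props(2)[OF model Q basis n j[OF that]] by auto
  have AX: "(\<lambda>\<omega>. ?A (X \<omega>)) \<in> borel_measurable Q" and BX: "(\<lambda>\<omega>. ?B (X \<omega>)) \<in> borel_measurable Q"
    unfolding dnorm_def by measurable
  have AB: "?A x = ?A x'" "?B x = ?B x'" if "\<forall>i\<in>{1..d}. x i = x' i" for x x' :: "nat \<Rightarrow> real"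
  proof -
    have "dnorm d x = dnorm d x'" by (rule dnorm_cong) (use that in blast)
    thus "?A x = ?A x'" "?B x = ?B x'"
      by (intro arg_cong[where f = "\<lambda>x. x\<^sup>2"] dnorm_cong; use that in simp)+
  qed
  \<comment> \<open>The coefficients coincide with the path increments outside a null set for each
    \<open>i\<close>; finitely many null sets are discarded together.\<close>
  have "AE \<omega> in Q. \<forall>i\<in>{1..d}. ?h (?y \<omega>) i = X \<omega> i"
  proof (rule AE_finite_allI)
    fix i assume i: "i \<in> {1..d}"
    show "AE \<omega> in Q. ?h (?y \<omega>) i = X \<omega> i"
      using xi_coeff_props(1)[OF model Q basis n j[OF i]]
    proof eventually_elim
      case (elim \<omega>)
      show ?case
        unfolding X_def elim theta_hat_signal_plus_noise[OF S basis n j[OF i]]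
        using n by (simp add: divide_divide_eq_left)
    qed
  qed simp
  hence "AE \<omega> in Q. ?A (?h (?y \<omega>)) = ?A (X \<omega>) \<and> ?B (?h (?y \<omega>)) = ?B (X \<omega>)"
  proof eventually_elim
    case (elim \<omega>)
    show ?case using AB[OF elim] by blast
  qed
  hence eqA: "AE \<omega> in Q. ?A (?h (?y \<omega>)) = ?A (X \<omega>)" and eqB: "AE \<omega> in Q. ?B (?h (?y \<omega>)) = ?B (X \<omega>)"
    by auto
  \<comment> \<open>The norm reads only coordinates in \<open>{1..d}\<close>, where the indicator in
    \<open>theta_star\<close> equals one.\<close>
  have star: "(dnorm d (\<lambda>j. theta_star n p d \<phi> c y j - ?t j))\<^sup>2 = ?A (?h y)" for y
    by (intro arg_cong[where f = "\<lambda>x. x\<^sup>2"] dnorm_cong) (simp add: theta_star_def)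
  have "(\<integral>y. ?A (?h y) \<partial>distr Q ?P ?y) = (\<integral>\<omega>. ?A (?h (?y \<omega>)) \<partial>Q)"
    by (rule integral_distr[OF y Am])
  also have "\<dots> = (\<integral>\<omega>. ?A (X \<omega>) \<partial>Q)"
    by (rule integral_cong_AE[OF measurable_compose[OF y Am] AX eqA])
  finally have 1: "(\<integral>y. ?A (?h y) \<partial>distr Q ?P ?y) = (\<integral>\<omega>. ?A (X \<omega>) \<partial>Q)" .
  have "(\<integral>y. ?B (?h y) \<partial>distr Q ?P ?y) = (\<integral>\<omega>. ?B (?h (?y \<omega>)) \<partial>Q)"
    by (rule integral_distr[OF y Bm])
  also have "\<dots> = (\<integral>\<omega>. ?B (X \<omega>) \<partial>Q)"
    by (rule integral_cong_AE[OF measurable_compose[OF y Bm] BX eqB])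
  finally have 2: "(\<integral>y. ?B (?h y) \<partial>distr Q ?P ?y) = (\<integral>\<omega>. ?B (X \<omega>) \<partial>Q)" .
  show ?thesis
    unfolding risk_diff_def observation_law_def star 1 2 ..
qed

text \<open>The abstract bounds are used with the noise \<open>Z = \<sigma> \<xi>\<close>, signal
  radius \<open>R = r\<close>, and \<open>a^2 = d / n\<close> times \<open>kappa_star\<close>. These
  choices make the lower bound for the gain coincide with \<open>c\<close>.\<close>

lemma risk_diff_bound:
  assumes model: "noise_model (real n) \<Omega> \<xi> \<Q> \<kappa>" and Q: "Q \<in> \<Q>" and bdd: "bdd_above (\<kappa> ` \<Q>)"
    and basis: "grid_basis p \<phi> \<phi>s" and n: "n \<ge> 1" and d: "d \<ge> 1" and dp: "d \<le> p"
    and S: "S \<in> signal_class L r" and r: "0 < r"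
    and H2: "cond_H2 n p d \<phi> \<xi> \<Q> l" and c: "c = shrink_const n d l r (kappa_star \<Q> \<kappa>)"
  shows "risk_diff n p d \<phi> c \<xi> Q S \<le> - c\<^sup>2 + 2 * sqrt (real d) * \<phi>s * L / real p * c"
proof -
  have p: "p \<ge> 1" using d dp by simp
  interpret prob_space Q using model Q unfolding noise_model_def by blast
  let ?\<xi> = "xi_coeff n p \<phi> Q \<xi>" and ?b = "theta_bar p \<phi> S" and ?t = "theta p \<phi> S"
  define \<sigma> where "\<sigma> = 1 / sqrt (real n)"
  define Z where "Z = (\<lambda>i \<omega>. \<sigma> * ?\<xi> i \<omega>)"
  define X where "X = (\<lambda>\<omega> i. ?b i + Z i \<omega>)"
  define a where "a = sqrt (real d / real n * kappa_star \<Q> \<kappa>)"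
  define e where "e = sqrt (real d) * (\<phi>s * L / real p)"
  have \<sigma>: "0 < \<sigma>" "\<sigma>\<^sup>2 = 1 / real n" using n by (auto simp: \<sigma>_def power_divide)
  have j: "i \<in> {1..p}" if "i \<in> {1..d}" for i using that dp by auto
  note \<xi> = xi_coeff_props[OF model Q basis n j]
  have Zm: "Z i \<in> borel_measurable Q" if "i \<in> {1..d}" for i
    using \<xi>(2)[OF that] unfolding Z_def by auto
  have Z2: "integrable Q (\<lambda>\<omega>. (Z i \<omega>)\<^sup>2)" if "i \<in> {1..d}" for i
    using \<xi>(3)[OF that] unfolding Z_def power_mult_distrib by (rule integrable_mult_right)
  have l: "0 < l" using H2 by (simp add: cond_H2_def)
  have \<kappa>: "0 < \<kappa> Q" "\<kappa> Q \<le> kappa_star \<Q> \<kappa>"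
    using model Q bdd by (auto simp: noise_model_def kappa_star_def intro: cSUP_upper)
  have a: "0 < a" "a\<^sup>2 = real d / real n * kappa_star \<Q> \<kappa>"
    using \<kappa> d n by (auto simp: a_def)
  have c_eq: "c = \<sigma>\<^sup>2 * l / (r + a)"
    by (simp add: c shrink_const_def a_def \<sigma>)
  have c_pos: "0 < c" using l r a(1) \<sigma>(1) by (simp add: c_eq)
  have "expectation (\<lambda>\<omega>. (Z i \<omega>)\<^sup>2) \<le> kappa_star \<Q> \<kappa> / real n" if "i \<in> {1..d}" for i
  proof -
    have "expectation (\<lambda>\<omega>. (Z i \<omega>)\<^sup>2) = \<sigma>\<^sup>2 * expectation (\<lambda>\<omega>. (?\<xi> i \<omega>)\<^sup>2)"
      unfolding Z_def power_mult_distrib by simp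
    also have "\<dots> \<le> \<sigma>\<^sup>2 * kappa_star \<Q> \<kappa>"
      using \<xi>(4)[OF that] \<kappa>(2) by (intro mult_left_mono) auto
    finally show ?thesis by (simp add: \<sigma>)
  qed
  hence "(\<Sum>i = 1..d. expectation (\<lambda>\<omega>. (Z i \<omega>)\<^sup>2)) \<le> (\<Sum>i = 1..d. kappa_star \<Q> \<kappa> / real n)"
    by (rule sum_mono)
  hence noise: "(\<Sum>i = 1..d. expectation (\<lambda>\<omega>. (Z i \<omega>)\<^sup>2)) \<le> a\<^sup>2"
    unfolding a by simp
  obtain F where F: "subalgebra Q F" and G: "conditionally_gaussian Q F d ?\<xi>"
    and gap: "AE \<omega> in Q. l \<le> (\<Sum>i = 1..d. cond_cov Q F ?\<xi> \<omega> i i) - lambda_max d (cond_cov Q F ?\<xi> \<omega>)"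
    using H2 Q unfolding cond_H2_def Let_def by blast
  have reg: "0 \<le> expectation (\<lambda>\<omega>. ((\<Sum>i = 1..d. X \<omega> i * Z i \<omega>) - \<sigma>\<^sup>2 * l) / sqrt ((dnorm d (X \<omega>))\<^sup>2 + \<epsilon>))"
    if \<epsilon>: "0 < \<epsilon>" for \<epsilon>
  proof -
    have "0 \<le> expectation (\<lambda>\<omega>. ((\<Sum>i = 1..d. X \<omega> i * ?\<xi> i \<omega>) - \<sigma> * l) / sqrt ((dnorm d (X \<omega>))\<^sup>2 + \<epsilon>))"
      unfolding X_def Z_def
      by (rule conditionally_gaussian_shrinkage_inequality[OF prob_space_axioms F G gap d less_imp_le[OF l] \<sigma>(1) \<epsilon> \<xi>(2)])
    \<comment> \<open>Condition \<open>H2\<close> concerns the normalized coefficients, while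
      \<open>shrinkage_gain\<close> wants the scaled noise. Multiplying by \<open>\<sigma>\<close>
      changes the former into the latter and \<open>\<sigma> * l\<close> into
      \<open>l / n\<close>.\<close>
    hence "0 \<le> \<sigma> * expectation (\<lambda>\<omega>. ((\<Sum>i = 1..d. X \<omega> i * ?\<xi> i \<omega>) - \<sigma> * l) / sqrt ((dnorm d (X \<omega>))\<^sup>2 + \<epsilon>))"
      using \<sigma>(1) by simp
    also have "\<dots> = expectation (\<lambda>\<omega>. \<sigma> * (((\<Sum>i = 1..d. X \<omega> i * ?\<xi> i \<omega>) - \<sigma> * l) / sqrt ((dnorm d (X \<omega>))\<^sup>2 + \<epsilon>)))"
      by (rule integral_mult_right_zero[symmetric])
    also have "(\<lambda>\<omega>. \<sigma> * (((\<Sum>i = 1..d. X \<omega> i * ?\<xi> i \<omega>) - \<sigma> * l) / sqrt ((dnorm d (X \<omega>))\<^sup>2 + \<epsilon>))) =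
        (\<lambda>\<omega>. ((\<Sum>i = 1..d. X \<omega> i * Z i \<omega>) - \<sigma>\<^sup>2 * l) / sqrt ((dnorm d (X \<omega>))\<^sup>2 + \<epsilon>))"
      by (simp add: Z_def fun_eq_iff right_diff_distrib sum_distrib_left power2_eq_square mult_ac)
    finally show ?thesis .
  qed
  have gain: "c \<le> expectation (\<lambda>\<omega>. (\<Sum>i = 1..d. X \<omega> i * Z i \<omega>) / dnorm d (X \<omega>))"
    unfolding c_eq X_def
    by (rule shrinkage_gain[OF Zm Z2 theta_bar_bessel[OF S basis dp p] r a(1) noise _ reg[unfolded X_def]])
       (use l in auto)
  have \<phi>s: "0 \<le> \<phi>s"
    using grid_basisD(3)[OF basis, of 1 1] p by (auto intro: order_trans[OF abs_ge_zero])
  have L: "0 \<le> L" using S by (auto simp: signal_class_def intro: lipschitz_on_nonneg)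
  have bias: "dnorm d (\<lambda>i. ?b i - ?t i) \<le> e"
    unfolding e_def using \<phi>s L by (intro dnorm_le_const theta_bar_approx[OF S basis j]) auto
  have "risk_diff n p d \<phi> c \<xi> Q S =
      expectation (\<lambda>\<omega>. (dnorm d (\<lambda>i. (1 - c / dnorm d (X \<omega>)) * X \<omega> i - ?t i))\<^sup>2) -
      expectation (\<lambda>\<omega>. (dnorm d (\<lambda>i. X \<omega> i - ?t i))\<^sup>2)"
    using risk_diff_eq[OF model Q basis n p dp S, of c] by (simp add: X_def Z_def \<sigma>_def)
  also have "\<dots> \<le> c\<^sup>2 + 2 * c * e - 2 * c * expectation (\<lambda>\<omega>. (\<Sum>i = 1..d. X \<omega> i * Z i \<omega>) / dnorm d (X \<omega>))"
    unfolding X_def by (rule shrinkage_risk[OF Zm Z2 less_imp_le[OF c_pos] bias])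
  \<comment> \<open>Inserting the gain turns \<open>c^2\<close> into \<open>- c^2\<close>; the
    remaining \<open>2 * c * e\<close> is the discretization bias, with a factor
    \<open>sqrt d\<close> from passing from coordinates to the norm.\<close>
  also have "\<dots> \<le> c\<^sup>2 + 2 * c * e - 2 * c * c"
    using c_pos gain by (intro diff_left_mono mult_left_mono) auto
  also have "\<dots> = - c\<^sup>2 + 2 * sqrt (real d) * \<phi>s * L / real p * c"
    by (simp add: e_def power2_eq_square)
  finally show ?thesis .
qed

theorem theorem3p2:
  fixes \<Omega> :: "nat \<Rightarrow> 'a measure"
    and \<xi> :: "nat \<Rightarrow> real \<Rightarrow> 'a \<Rightarrow> real"
    and \<Q> :: "nat \<Rightarrow> 'a measure set"
    and \<kappa> :: "nat \<Rightarrow> 'a measure \<Rightarrow> real"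
    and r :: "nat \<Rightarrow> real"
    and l :: "nat \<Rightarrow> nat \<Rightarrow> real"
    and \<phi> :: "nat \<Rightarrow> real \<Rightarrow> real"
    and \<phi>s L c :: real
    and n p d :: nat
  assumes model: "\<And>m. m \<ge> 1 \<Longrightarrow> noise_model (real m) (\<Omega> m) (\<xi> m) (\<Q> m) (\<kappa> m)"
    and H1: "cond_H1 \<Q> \<kappa>"
    and r_pos: "\<And>m. m \<ge> 1 \<Longrightarrow> r m > 0"
    and r_growth: "\<And>\<epsilon>. \<epsilon> > 0 \<Longrightarrow> (\<lambda>m. real m powr (- \<epsilon>) * r m) \<longlonglongrightarrow> 0"
    and n: "n \<ge> 1" and d: "d \<ge> 2" and p: "p \<ge> 1" and dp: "d \<le> p"
    and basis: "grid_basis p \<phi> \<phi>s" and \<phi>s: "\<phi>s \<ge> 1"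
    and H2: "cond_H2 n p d \<phi> (\<xi> n) (\<Q> n) (l p d)"
    and L: "L \<ge> 0"
  defines "c \<equiv> shrink_const n d (l p d) (r n) (kappa_star (\<Q> n) (\<kappa> n))"
  shows "(SUP Q\<in>\<Q> n. SUP S\<in>signal_class L (r n). ereal (risk_diff n p d \<phi> c (\<xi> n) Q S))
           \<le> ereal (- c\<^sup>2 + 2 * sqrt (real d) * \<phi>s * L / real p * c)"
proof (intro SUP_least)
  fix Q S assume Q: "Q \<in> \<Q> n" and S: "S \<in> signal_class L (r n)"
  have bdd: "bdd_above (\<kappa> n ` \<Q> n)" using H1 n by (simp add: cond_H1_def)
  have d1: "d \<ge> 1" using d by simp
  show "ereal (risk_diff n p d \<phi> c (\<xi> n) Q S) \<le> ereal (- c\<^sup>2 + 2 * sqrt (real d) * \<phi>s * L / real p * c)"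
    unfolding ereal_less_eq
    by (rule risk_diff_bound[OF model[OF n] Q bdd basis n d1 dp S r_pos[OF n] H2]) (simp add: c_def)
qed

end
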